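(* Let $n\ge1$, let $d$ be a positive even integer, let $K\subset\mathbb{R}^n$ be compact with nonempty interior (not necessarily convex), and consider the optimization problem $$\mathcal{P}:\qquad \rho=\min_{a\in\mathbb{R}^n,\ g\in P[x]_d}\left\{\mathrm{vol}(G_1^a)\;:\;1-g_a\in C_d(K)\right\},$$ where $g_a(x):=g(x-a)$ and $G_1^a:=\{x\in\mathbb{R}^n: g(x-a)\le 1\}$. (a) $\mathcal{P}$ has an optimal solution $(a^*,g^* )\in\mathbb{R}^n\times P[x]_d$. (b) Let $(a^*,g^* )\in\mathbb{R}^n\times P[x]_d$ be an optimal solution of $\mathcal{P}$. If $g^*\in\mathrm{int}(P[x]_d)$, then there exists a finite Borel measure $\mu^*\in\mathcal{M}(K-a^* )_+$ such that $$\int_{\mathbb{R}^n}x^\alpha\exp(-g^*(x))\,dx=\int_{K-a^*}x^\alpha\,d\mu^*\qquad\text{for all }\alpha\in\mathbb{N}^n\text{ with }|\alpha|=d,$$ $$\int_{K-a^*}(1-g^* )\,d\mu^*=0,\qquad \mu^*(K-a^* )=\frac{n}{d}\int_{\mathbb{R}^n}\exp(-g^*(x))\,dx.$$ In particular, $\mu^*$ is supported on the set $V:=\{x\in K-a^*: g^*(x)=1\}$, and in fact $\mu^*$ can be substituted with another measure $\nu^*\in\mathcal{M}(K-a^* )_+$ supported on at most $\binom{n+d-1}{d}$ points of $V$ and having the same moments of order $d$ as $\mu^*$ (i.e. the same integrals of $x^\alpha$ for all $|\alpha|=d$).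
   Context: For $\alpha\in\mathbb{N}^n$, $|\alpha|=\sum_i\alpha_i$ and $x^\alpha=x_1^{\alpha_1}\cdots x_n^{\alpha_n}$. $H[x]_d$ is the vector space of real homogeneous polynomials of degree $d$ in $x=(x_1,\ldots,x_n)$ (including $0$). $P[x]_d\subset H[x]_d$ is the set of those $g\in H[x]_d$ whose sublevel set $\{x\in\mathbb{R}^n: g(x)\le 1\}$ has finite Lebesgue volume; $\mathrm{int}(P[x]_d)$ is its interior in $H[x]_d$. $C_d(K)$ is the convex cone of real polynomials of degree at most $d$ that are nonnegative on $K$. $K-a:=\{x-a: x\in K\}$. For a compact set $S$, $\mathcal{M}(S)_+$ is the convex cone of finite (positive) Borel measures with support contained in $S$. $\mathrm{vol}$ is Lebesgue measure on $\mathbb{R}^n$. *)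

theory Defs
  imports "HOL-Analysis.Analysis"
begin

text \<open>
  The space \<open>\<real>\<^sup>n\<close> is \<open>real ^ 'n\<close>, with \<open>n = CARD('n) \<ge> 1\<close>.
  Multi-indices are functions \<open>'n \<Rightarrow> nat\<close>, and real polynomials are identified with the
  polynomial functions they induce (the identification is injective over \<open>\<real>\<close>).
\<close>

definition mdeg :: "('n::finite \<Rightarrow> nat) \<Rightarrow> nat" where
  "mdeg \<alpha> = (\<Sum>i\<in>UNIV. \<alpha> i)"

definition mpow :: "real ^ 'n \<Rightarrow> ('n::finite \<Rightarrow> nat) \<Rightarrow> real" where
  "mpow x \<alpha> = (\<Prod>i\<in>UNIV. (x $ i) ^ \<alpha> i)"

definition hom_polys :: "nat \<Rightarrow> (real ^ 'n::finite \<Rightarrow> real) set" where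
  "hom_polys d = {g. \<exists>c. \<forall>x. g x = (\<Sum>\<alpha> | mdeg \<alpha> = d. c \<alpha> * mpow x \<alpha>)}"

definition polys_le :: "nat \<Rightarrow> (real ^ 'n::finite \<Rightarrow> real) set" where
  "polys_le d = {p. \<exists>c. \<forall>x. p x = (\<Sum>\<alpha> | mdeg \<alpha> \<le> d. c \<alpha> * mpow x \<alpha>)}"

definition finvol_polys :: "nat \<Rightarrow> (real ^ 'n::finite \<Rightarrow> real) set" where
  "finvol_polys d = {g \<in> hom_polys d. emeasure lebesgue {x. g x \<le> 1} < \<infinity>}"

text \<open>
  The finite-dimensional vector space \<^term>\<open>hom_polys d\<close> carries a unique Hausdorff vector
  space topology (that of any norm, e.g. of the coefficients). It is the one induced by
  the product topology on \<open>real ^ 'n \<Rightarrow> real\<close>, in which the interior is taken.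
\<close>

definition int_finvol_polys :: "nat \<Rightarrow> (real ^ 'n::finite \<Rightarrow> real) set" where
  "int_finvol_polys d = (top_of_set (hom_polys d)) interior_of (finvol_polys d)"

definition nonneg_polys :: "nat \<Rightarrow> (real ^ 'n::finite) set \<Rightarrow> (real ^ 'n \<Rightarrow> real) set" where
  "nonneg_polys d K = {p \<in> polys_le d. \<forall>x\<in>K. p x \<ge> 0}"

definition translate :: "(real ^ 'n::finite) set \<Rightarrow> real ^ 'n \<Rightarrow> (real ^ 'n) set" where
  "translate K a = {x - a | x. x \<in> K}"

definition feasible ::
  "(real ^ 'n::finite) set \<Rightarrow> nat \<Rightarrow> real ^ 'n \<Rightarrow> (real ^ 'n \<Rightarrow> real) \<Rightarrow> bool" where
  "feasible K d a g \<longleftrightarrow> g \<in> finvol_polys d \<and> (\<lambda>x. 1 - g (x - a)) \<in> nonneg_polys d K"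

definition objective :: "real ^ 'n::finite \<Rightarrow> (real ^ 'n \<Rightarrow> real) \<Rightarrow> ennreal" where
  "objective a g = emeasure lebesgue {x. g (x - a) \<le> 1}"

definition optimal ::
  "(real ^ 'n::finite) set \<Rightarrow> nat \<Rightarrow> real ^ 'n \<Rightarrow> (real ^ 'n \<Rightarrow> real) \<Rightarrow> bool" where
  "optimal K d a g \<longleftrightarrow> feasible K d a g \<and>
     (\<forall>b h. feasible K d b h \<longrightarrow> objective a g \<le> objective b h)"

definition supp :: "(real ^ 'n::finite) measure \<Rightarrow> (real ^ 'n) set" where
  "supp \<mu> = {x. \<forall>U. open U \<and> x \<in> U \<longrightarrow> emeasure \<mu> U > 0}"

definition meas_on :: "(real ^ 'n::finite) set \<Rightarrow> (real ^ 'n) measure set" where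
  "meas_on S = {\<mu>. sets \<mu> = sets borel \<and> finite_measure \<mu> \<and> supp \<mu> \<subseteq> S}"

end

theory Submission
  imports Defs "HOL-Computational_Algebra.Polynomial"
begin

text \<open>
  Existence is a compactness argument. A polynomial \<open>g\<close> whose sublevel set has finite volume is
  nonnegative, so by homogeneity its sublevel set is star-shaped about the origin; after
  translation it also contains a fixed ball inside \<open>K\<close>. If the centre \<open>a\<close> runs far away from this
  ball, the sublevel set contains many disjoint smaller balls on the way to the centre
  (\<open>norm_center_le\<close>), so the centres of a minimising sequence stay bounded. The polynomials are then
  bounded by \<open>1\<close> on a common ball, and since a polynomial is a fixed combination of its values at
  finitely many nodes of that ball (\<open>hom_polys_interpolation\<close>), a subsequence converges pointwise.
  Fatou's lemma bounds the volume of \<open>{g < 1}\<close> for the limit \<open>g\<close>, and homogeneity turns this into a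
  bound for \<open>{g \<le> 1}\<close>.

  For optimality, slicing \<open>exp (- g)\<close> along the sublevel sets of \<open>g\<close> shows that the volume of
  \<open>{g \<le> 1}\<close> is a constant multiple of the integral of \<open>exp (- g)\<close> (\<open>nn_integral_exp_neg\<close>), which is
  a convex function of \<open>g\<close> with directional derivative \<open>- \<integral> h exp (- g)\<close>. Write \<open>V\<close> for the set of
  points of \<open>K - a\<close> where the constraint \<open>g \<le> 1\<close> is active. At an optimal \<open>g\<close> in the interior, no
  form \<open>h\<close> that is negative on \<open>V\<close> can have \<open>\<integral> h exp (- g) > 0\<close>
  (\<open>optimal_no_descent_direction\<close>). By a Farkas alternative (\<open>conic_alternative\<close>) this puts the vector
  of moments \<open>\<integral> x\<^sup>\<alpha> exp (- g)\<close>, \<open>|\<alpha>| = d\<close>, into the convex cone spanned by the monomial vectors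
  \<open>(x\<^sup>\<alpha>)\<close> of points \<open>x\<close> of \<open>V\<close>. The alternative already comes with Caratheodory's bound on the
  number of generators, so the resulting discrete measure serves both as \<open>\<mu>\<close> and as \<open>\<nu>\<close>. As \<open>g = 1\<close>
  on \<open>V\<close>, its mass is \<open>\<integral> g exp (- g)\<close>, which Euler's identity (\<open>euler_identity\<close>) evaluates.
\<close>

section \<open>Finite families of functions and the cones they span\<close>

text \<open>
  Interpolation by induction on the family: a new function either is reproduced by the nodes
  found so far, or its interpolation error is nonzero at some point, which becomes a new node. The
  functions \<open>L x\<close> generalise the Lagrange basis. Besides interpolating polynomials, the lemma
  provides linear dependences: more than \<open>card I\<close> vectors indexed by \<open>I\<close> include one that is a
  combination of others, as seen by letting \<open>S\<close> enumerate the vectors.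
\<close>

lemma interpolation_nodes:
  fixes f :: "'i \<Rightarrow> 's \<Rightarrow> real"
  assumes "finite I"
  shows "\<exists>X L. finite X \<and> X \<subseteq> S \<and> card X \<le> card I
    \<and> (\<forall>x\<in>X. \<exists>c. \<forall>s. L x s = (\<Sum>k\<in>I. c k * f k s))
    \<and> (\<forall>x\<in>X. \<forall>x'\<in>X. L x x' = of_bool (x = x'))
    \<and> (\<forall>i\<in>I. \<forall>s\<in>S. f i s = (\<Sum>x\<in>X. f i x * L x s))"
  using assms
proof (induction I)
  case empty
  then show ?case by (intro exI[of _ "{}"]) auto
next
  case (insert i0 I)
  then obtain X L where X: "finite X" "X \<subseteq> S" "card X \<le> card I"
    and span: "\<forall>x\<in>X. \<exists>c. \<forall>s. L x s = (\<Sum>k\<in>I. c k * f k s)"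
    and delta: "\<forall>x\<in>X. \<forall>x'\<in>X. L x x' = of_bool (x = x')"
    and rep: "\<forall>i\<in>I. \<forall>s\<in>S. f i s = (\<Sum>x\<in>X. f i x * L x s)"
    by blast
  from span obtain c where c: "\<And>x s. x \<in> X \<Longrightarrow> L x s = (\<Sum>k\<in>I. c x k * f k s)"
    by metis
  \<comment> \<open>The interpolation error of the new function; \<open>cb\<close> are its coefficients.\<close>
  define b where "b s = f i0 s - (\<Sum>x\<in>X. f i0 x * L x s)" for s
  define cb where "cb k = (if k = i0 then 1 else - (\<Sum>x\<in>X. f i0 x * c x k))" for k
  have cong: "(\<Sum>k\<in>I. (if k = i0 then a else e k) * f k s) = (\<Sum>k\<in>I. e k * f k s)" for a e s
    using insert.hyps by (intro sum.cong) auto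
  have cb: "b s = (\<Sum>k\<in>insert i0 I. cb k * f k s)" for s
  proof -
    have "(\<Sum>x\<in>X. f i0 x * L x s) = (\<Sum>x\<in>X. \<Sum>k\<in>I. f i0 x * c x k * f k s)"
      by (intro sum.cong) (auto simp: c sum_distrib_left mult.assoc)
    also have "\<dots> = (\<Sum>k\<in>I. (\<Sum>x\<in>X. f i0 x * c x k) * f k s)"
      by (subst sum.swap) (simp add: sum_distrib_right)
    finally show ?thesis using insert.hyps
      by (simp add: b_def cb_def cong sum_negf)
  qed
  have spanI: "\<exists>e. \<forall>s. L x s + r * b s = (\<Sum>k\<in>insert i0 I. e k * f k s)" if "x \<in> X" for x r
  proof -
    define e where "e k = (if k = i0 then 0 else c x k) + r * cb k" for k
    have "L x s + r * b s = (\<Sum>k\<in>insert i0 I. e k * f k s)" for s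
      using insert.hyps
      by (simp add: e_def c[OF that] cb distrib_right sum.distrib cong sum_distrib_left mult.assoc distrib_left)
    then show ?thesis by blast
  qed
  \<comment> \<open>The error vanishes at the old nodes, so normalising it at \<open>s0\<close> keeps the Lagrange property.\<close>
  have bX: "b x = 0" if "x \<in> X" for x
  proof -
    have "(\<Sum>x'\<in>X. f i0 x' * L x' x) = (\<Sum>x'\<in>X. if x' = x then f i0 x' else 0)"
      using delta that by (intro sum.cong) auto
    then show ?thesis using X that by (simp add: b_def)
  qed
  show ?case
  proof (cases "\<forall>s\<in>S. b s = 0")
    case True
    have "\<exists>e. \<forall>s. L x s = (\<Sum>k\<in>insert i0 I. e k * f k s)" if "x \<in> X" for x
      using spanI[OF that, of 0] by simp
    moreover have "\<forall>i\<in>insert i0 I. \<forall>s\<in>S. f i s = (\<Sum>x\<in>X. f i x * L x s)"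
      using True rep by (auto simp: b_def)
    moreover have "card X \<le> card (insert i0 I)" using X insert.hyps by simp
    ultimately show ?thesis using X delta by blast
  next
    case False
    then obtain s0 where s0: "s0 \<in> S" "b s0 \<noteq> 0" by blast
    then have "s0 \<notin> X" using bX by auto
    define L' where "L' x s = (if x = s0 then b s / b s0 else L x s - L x s0 / b s0 * b s)" for x s
    have L's0: "L' s0 s = b s / b s0" for s by (simp add: L'_def)
    have L'X: "L' x s = L x s - L x s0 / b s0 * b s" if "x \<in> X" for x s
      using that \<open>s0 \<notin> X\<close> by (auto simp: L'_def)
    have "\<exists>e. \<forall>s. L' x s = (\<Sum>k\<in>insert i0 I. e k * f k s)" if "x \<in> insert s0 X" for x
    proof (cases "x = s0")
      case True
      have "L' x s = (\<Sum>k\<in>insert i0 I. (cb k / b s0) * f k s)" for s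
        by (simp only: True L's0 cb sum_divide_distrib times_divide_eq_left)
      then show ?thesis by (intro exI[of _ "\<lambda>k. cb k / b s0"] allI)
    next
      case False
      then show ?thesis using spanI[of x "- (L x s0 / b s0)"] that L'X by auto
    qed
    moreover have "\<forall>x\<in>insert s0 X. \<forall>x'\<in>insert s0 X. L' x x' = of_bool (x = x')"
      using delta bX s0 \<open>s0 \<notin> X\<close> by (auto simp: L's0 L'X)
    moreover have "f i s = (\<Sum>x\<in>insert s0 X. f i x * L' x s)"
      if "i \<in> insert i0 I" "s \<in> S" for i s
    proof -
      have "(\<Sum>x\<in>insert s0 X. f i x * L' x s)
        = f i s0 * (b s / b s0) + (\<Sum>x\<in>X. f i x * L x s - (f i x * L x s0) * (b s / b s0))"
        using X \<open>s0 \<notin> X\<close> by (simp add: L's0 L'X algebra_simps)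
      also have "\<dots> = (\<Sum>x\<in>X. f i x * L x s) + (f i s0 - (\<Sum>x\<in>X. f i x * L x s0)) * (b s / b s0)"
        by (simp add: sum_subtractf left_diff_distrib sum_distrib_right sum_divide_distrib diff_divide_distrib)
      also have "\<dots> = f i s"
      proof (cases "i = i0")
        case True
        have "(f i s0 - (\<Sum>x\<in>X. f i x * L x s0)) * (b s / b s0) = b s"
          using s0 by (simp add: True flip: b_def)
        then show ?thesis by (simp add: b_def True)
      next
        case False
        then have "i \<in> I" using that by simp
        then show ?thesis using rep s0 that by simp
      qed
      finally show ?thesis ..
    qed
    moreover have "card (insert s0 X) \<le> card (insert i0 I)" using X insert.hyps \<open>s0 \<notin> X\<close> by simp
    ultimately show ?thesis using X s0
      by (intro exI[of _ "insert s0 X"] exI[of _ L']) auto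
  qed
qed

text \<open>
  As long as there are more than \<open>card I\<close> generators, a linear dependence \<open>v\<close> among them can be
  subtracted from the weights until the first weight vanishes, which removes one generator.
\<close>

lemma conic_caratheodory:
  fixes f :: "'i \<Rightarrow> 'j \<Rightarrow> real"
  assumes "finite I" "finite J" "\<forall>j\<in>J. 0 \<le> w j"
  shows "\<exists>J' w'. J' \<subseteq> J \<and> card J' \<le> card I \<and> (\<forall>j\<in>J'. 0 \<le> w' j)
    \<and> (\<forall>i\<in>I. (\<Sum>j\<in>J'. w' j * f i j) = (\<Sum>j\<in>J. w j * f i j))"
  using assms(2,3)
proof (induction "card J" arbitrary: J w rule: less_induct)
  case less
  show ?case
  proof (cases "card J \<le> card I")
    case True
    then show ?thesis using less.prems by blast
  next
    case False
    obtain X L where X: "finite X" "X \<subseteq> J" "card X \<le> card I"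
      and rep: "\<And>i s. i \<in> I \<Longrightarrow> s \<in> J \<Longrightarrow> f i s = (\<Sum>x\<in>X. f i x * L x s)"
      using interpolation_nodes[OF assms(1), of J f] by blast
    then obtain j0 where j0: "j0 \<in> J" "j0 \<notin> X" using False
      by (metis card_mono less.prems(1) le_trans subsetI finite_subset)
    define v where "v j = (if j = j0 then 1 else if j \<in> X then - L j j0 else 0)" for j
    have v: "(\<Sum>j\<in>J. v j * f i j) = 0" if "i \<in> I" for i
    proof -
      have "(\<Sum>j\<in>J. v j * f i j) = (\<Sum>j\<in>insert j0 X. v j * f i j)"
        using X j0 less.prems by (intro sum.mono_neutral_right) (auto simp: v_def)
      also have "\<dots> = f i j0 + (\<Sum>j\<in>X. - (f i j * L j j0))"
        using X j0 by (simp add: v_def) (intro sum.cong, auto)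
      also have "\<dots> = 0" using rep[OF that j0(1)] by (simp add: sum_negf)
      finally show ?thesis .
    qed
    define P where "P = {j\<in>J. v j > 0}"
    have P: "finite P" "P \<noteq> {}" using less.prems j0 by (auto simp: P_def v_def)
    \<comment> \<open>The largest multiple of \<open>v\<close> that keeps all weights nonnegative.\<close>
    define \<tau> where "\<tau> = Min ((\<lambda>j. w j / v j) ` P)"
    have "\<tau> \<in> (\<lambda>j. w j / v j) ` P" unfolding \<tau>_def using P by (intro Min_in) auto
    then obtain j1 where j1: "j1 \<in> P" "\<tau> = w j1 / v j1" by blast
    have \<tau>le: "\<tau> \<le> w j / v j" if "j \<in> P" for j using P that by (simp add: \<tau>_def)
    have "\<tau> \<ge> 0" using j1 less.prems by (auto simp: P_def)
    define w1 where "w1 j = w j - \<tau> * v j" for j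
    have w1: "0 \<le> w1 j" if "j \<in> J" for j
    proof (cases "v j > 0")
      case True
      then show ?thesis using \<tau>le[of j] that by (simp add: w1_def P_def field_simps)
    next
      case False
      then have "\<tau> * v j \<le> 0" using \<open>\<tau> \<ge> 0\<close> by (simp add: mult_nonneg_nonpos)
      moreover have "0 \<le> w j" using less.prems(2) that by blast
      ultimately show ?thesis by (simp add: w1_def)
    qed
    have "w1 j1 = 0" using j1 by (auto simp: w1_def P_def)
    have j1J: "j1 \<in> J" using j1 by (simp add: P_def)
    have eq: "(\<Sum>j\<in>J - {j1}. w1 j * f i j) = (\<Sum>j\<in>J. w j * f i j)" if "i \<in> I" for i
    proof -
      have "(\<Sum>j\<in>J - {j1}. w1 j * f i j) = (\<Sum>j\<in>J. w1 j * f i j)"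
        using less.prems \<open>w1 j1 = 0\<close> by (intro sum.mono_neutral_left) auto
      also have "\<dots> = (\<Sum>j\<in>J. w j * f i j) - \<tau> * (\<Sum>j\<in>J. v j * f i j)"
        by (simp add: w1_def left_diff_distrib sum_subtractf sum_distrib_left mult.assoc)
      finally show ?thesis using v[OF that] by simp
    qed
    have "card (J - {j1}) < card J" using j1J less.prems by (meson card_Diff1_less)
    from less.hyps[OF this, of w1] obtain J' w' where "J' \<subseteq> J - {j1}" "card J' \<le> card I" "\<forall>j\<in>J'. 0 \<le> w' j"
      "\<forall>i\<in>I. (\<Sum>j\<in>J'. w' j * f i j) = (\<Sum>j\<in>J - {j1}. w1 j * f i j)"
      using w1 less.prems by auto
    then show ?thesis using eq by (intro exI[of _ J'] exI[of _ w']) auto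
  qed
qed

lemma nonpos_of_le_quadratic:
  fixes a b :: real
  assumes "\<And>e. 0 < e \<Longrightarrow> e < 1 \<Longrightarrow> a * e \<le> b * e\<^sup>2"
  shows "a \<le> 0"
proof (rule tendsto_lowerbound)
  show "((\<lambda>e. b * e) \<longlongrightarrow> 0) (at_right 0)"
    by (rule tendsto_eq_intros | simp)+
  have "\<forall>\<^sub>F e in at_right 0. 0 < e \<and> e < (1::real)"
    using eventually_at_right_real[of 0 "1::real"] by (simp add: greaterThanLessThan_iff)
  then show "\<forall>\<^sub>F e in at_right 0. a \<le> b * e"
  proof eventually_elim
    case (elim e)
    then have "a * e \<le> (b * e) * e" using assms[of e] by (simp add: power2_eq_square)
    then show ?case using elim by (simp add: mult_le_cancel_right)
  qed
qed simp

text \<open>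
  A Farkas alternative for the cone generated by the vectors \<open>(f i v)\<close>, \<open>v \<in> V\<close>. The separating
  vector is the residual \<open>h\<close> of \<open>y\<close> at its nearest point in the cone. By Caratheodory the
  cone is parametrised by \<open>card I\<close> weighted points, and the nearest point exists because the
  normalisation \<open>\<Sum> c i f i = 1\<close> recovers the total weight from the vector, so that the weights
  may be taken from a compact interval.
\<close>

lemma conic_alternative:
  fixes f :: "'i \<Rightarrow> 'a::topological_space \<Rightarrow> real" and y :: "'i \<Rightarrow> real"
  assumes I: "finite I" and V: "compact V" "V \<noteq> {}"
    and cont: "\<And>i. i \<in> I \<Longrightarrow> continuous_on V (f i)"
    and c: "\<And>v. v \<in> V \<Longrightarrow> (\<Sum>i\<in>I. c i * f i v) = 1"
  shows "(\<exists>w x. (\<forall>j<card I. 0 \<le> w j \<and> x j \<in> V) \<and>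
            (\<forall>i\<in>I. y i = (\<Sum>j<card I. w j * f i (x j))))
    \<or> (\<exists>h. (\<Sum>i\<in>I. h i * y i) > 0 \<and> (\<forall>v\<in>V. (\<Sum>i\<in>I. h i * f i v) \<le> 0))"
proof -
  obtain v0 where v0: "v0 \<in> V" using V by blast
  define N where "N = card I"
  define q where "q u = (\<Sum>i\<in>I. (y i - u i)\<^sup>2)" for u
  define mom where "mom p i = (\<Sum>j<N. fst (p j) * f i (snd (p j)))" for p :: "nat \<Rightarrow> real \<times> 'a" and i
  define B where "B = sqrt (q (\<lambda>_. 0))"
  define R where "R = (\<Sum>i\<in>I. \<bar>c i\<bar> * (\<bar>y i\<bar> + B))"
  \<comment> \<open>Sequences of weighted points, of which only the first \<open>N\<close> enter; the product is compact by Tychonoff.\<close>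
  define D where "D = {p :: nat \<Rightarrow> real \<times> 'a. \<forall>j. p j \<in> {0..R} \<times> V}"
  have q0: "q u \<ge> 0" for u by (simp add: q_def sum_nonneg)
  have B0: "B \<ge> 0" using q0 by (simp add: B_def)
  have R0: "R \<ge> 0" unfolding R_def using B0 by (intro sum_nonneg) auto
  have D_PiE: "D = PiE UNIV (\<lambda>_. {0..R} \<times> V)" by (auto simp: D_def)
  have "compact ({0..R} \<times> V)" using V by (intro compact_Times) auto
  then have "compact D"
    unfolding D_PiE using compactin_PiE[of "\<lambda>_. euclidean" UNIV "\<lambda>_::nat. {0..R} \<times> V"]
    by (simp add: euclidean_product_topology compactin_euclidean_iff)
  moreover have "(\<lambda>_. (0, v0)) \<in> D" using R0 v0 by (auto simp: D_def)
  moreover have "continuous_on D (\<lambda>p. q (mom p))"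
  proof -
    have comp: "continuous_on D (\<lambda>p. p j)" for j
      by (rule continuous_on_subset[OF continuous_on_product_coordinates]) simp
    have "continuous_on D (\<lambda>p. f i (snd (p j)))" if "i \<in> I" for i j
      by (rule continuous_on_compose2[OF cont[OF that] continuous_on_snd[OF comp]])
        (auto simp: D_def mem_Times_iff)
    then show ?thesis unfolding q_def mom_def
      by (intro continuous_intros comp) auto
  qed
  ultimately obtain p where p: "p \<in> D" "\<And>p'. p' \<in> D \<Longrightarrow> q (mom p) \<le> q (mom p')"
    using continuous_attains_inf[of D "\<lambda>p. q (mom p)"] by blast
  have pw: "0 \<le> fst (p j)" and pV: "snd (p j) \<in> V" for j using p(1) by (auto simp: D_def mem_Times_iff)
  have qp0: "q (mom p) \<le> q (\<lambda>_. 0)"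
    using p(2)[OF \<open>(\<lambda>_. (0, v0)) \<in> D\<close>] by (simp add: mom_def[abs_def])
  \<comment> \<open>A combination at least as close to \<open>y\<close> as the apex \<open>0\<close> has total weight at most \<open>R\<close>.\<close>
  have minN: "q (mom p) \<le> q (mom p')" if p': "\<And>j. 0 \<le> fst (p' j) \<and> snd (p' j) \<in> V" for p'
  proof (cases "q (mom p') \<le> q (\<lambda>_. 0)")
    case False
    then show ?thesis using qp0 by simp
  next
    case True
    have umom: "\<bar>mom p' i\<bar> \<le> \<bar>y i\<bar> + B" if "i \<in> I" for i
    proof -
      have "(y i - mom p' i)\<^sup>2 \<le> q (mom p')"
        unfolding q_def using I that by (intro member_le_sum) auto
      then have "(y i - mom p' i)\<^sup>2 \<le> B\<^sup>2" using True q0 by (simp add: B_def)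
      then have "\<bar>y i - mom p' i\<bar> \<le> B" using B0 abs_le_square_iff[of "y i - mom p' i" B] by simp
      then show ?thesis by linarith
    qed
    have "(\<Sum>j<N. fst (p' j)) = (\<Sum>j<N. fst (p' j) * (\<Sum>i\<in>I. c i * f i (snd (p' j))))"
      using c p' by (intro sum.cong) auto
    also have "\<dots> = (\<Sum>i\<in>I. c i * mom p' i)"
      unfolding mom_def sum_distrib_left by (subst sum.swap) (simp add: mult_ac)
    also have "\<dots> \<le> R" unfolding R_def
    proof (rule sum_mono)
      fix i assume "i \<in> I"
      have "c i * mom p' i \<le> \<bar>c i\<bar> * \<bar>mom p' i\<bar>" by (metis abs_ge_self abs_mult)
      also have "\<dots> \<le> \<bar>c i\<bar> * (\<bar>y i\<bar> + B)" using umom[OF \<open>i \<in> I\<close>] by (intro mult_left_mono) auto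
      finally show "c i * mom p' i \<le> \<bar>c i\<bar> * (\<bar>y i\<bar> + B)" .
    qed
    finally have sumR: "(\<Sum>j<N. fst (p' j)) \<le> R" .
    define p'' where "p'' j = (if j < N then p' j else (0, v0))" for j
    have "fst (p' j) \<le> R" if "j < N" for j
      using member_le_sum[of j "{..<N}" "\<lambda>j. fst (p' j)"] p' that sumR by force
    then have "p'' \<in> D" using p' R0 v0 by (auto simp: D_def p''_def mem_Times_iff)
    moreover have "mom p'' = mom p'" by (auto simp: mom_def p''_def)
    ultimately show ?thesis using p(2) by metis
  qed
  have min: "q (mom p) \<le> q (\<lambda>i. \<Sum>j\<in>J. w j * f i (x j))"
    if J: "finite J" "\<And>j. j \<in> J \<Longrightarrow> 0 \<le> w j" "\<And>j. j \<in> J \<Longrightarrow> x j \<in> V" for J :: "nat set" and w x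
  proof -
    obtain J' w' where J': "J' \<subseteq> J" "card J' \<le> card I" "\<forall>j\<in>J'. 0 \<le> w' j"
      "\<forall>i\<in>I. (\<Sum>j\<in>J'. w' j * f i (x j)) = (\<Sum>j\<in>J. w j * f i (x j))"
      using conic_caratheodory[OF I J(1), of w "\<lambda>i j. f i (x j)"] J by blast
    have "finite J'" using J J' finite_subset by blast
    then obtain e where e: "bij_betw e {..<card J'} J'"
      using ex_bij_betw_nat_finite[of J'] by (auto simp: atLeast0LessThan)
    define p' where "p' j = (if j < card J' then (w' (e j), x (e j)) else (0, v0))" for j
    have "q (mom p) \<le> q (mom p')"
      using J' J e v0 by (intro minN) (auto simp: p'_def dest!: bij_betwE)
    also have "mom p' i = (\<Sum>j\<in>J'. w' j * f i (x j))" for i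
    proof -
      have "mom p' i = (\<Sum>j<card J'. fst (p' j) * f i (snd (p' j)))"
        unfolding mom_def using J' by (intro sum.mono_neutral_right) (auto simp: p'_def N_def)
      also have "\<dots> = (\<Sum>j<card J'. w' (e j) * f i (x (e j)))" by (simp add: p'_def)
      also have "\<dots> = (\<Sum>j\<in>J'. w' j * f i (x j))" by (rule sum.reindex_bij_betw[OF e])
      finally show ?thesis .
    qed
    then have "q (mom p') = q (\<lambda>i. \<Sum>j\<in>J. w j * f i (x j))"
      unfolding q_def using J' by (intro sum.cong) auto
    finally show ?thesis .
  qed
  define h where "h i = y i - mom p i" for i
  define hh where "hh = (\<Sum>i\<in>I. (h i)\<^sup>2)"
  have hh: "q (mom p) = hh" by (simp add: q_def hh_def h_def)
  have expand: "q (\<lambda>i. mom p i + e * z i) = hh - 2 * e * (\<Sum>i\<in>I. h i * z i) + e\<^sup>2 * (\<Sum>i\<in>I. (z i)\<^sup>2)" for e z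
  proof -
    have "(y i - (mom p i + e * z i))\<^sup>2 = (h i)\<^sup>2 - 2 * e * (h i * z i) + e\<^sup>2 * (z i)\<^sup>2" for i
      by (simp add: h_def power2_eq_square algebra_simps)
    then show ?thesis
      by (simp add: q_def hh_def sum.distrib sum_subtractf sum_distrib_left)
  qed
  \<comment> \<open>Minimality against adding a small multiple of one more generator.\<close>
  have hV: "(\<Sum>i\<in>I. h i * f i v) \<le> 0" if v: "v \<in> V" for v
  proof -
    have "2 * (\<Sum>i\<in>I. h i * f i v) * e \<le> (\<Sum>i\<in>I. (f i v)\<^sup>2) * e\<^sup>2" if "0 < e" for e
    proof -
      have "q (mom p) \<le> q (\<lambda>i. \<Sum>j\<in>{..N}. (if j < N then fst (p j) else e) * f i (if j < N then snd (p j) else v))"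
        using pw pV v that by (intro min) auto
      also have "(\<lambda>i. \<Sum>j\<in>{..N}. (if j < N then fst (p j) else e) * f i (if j < N then snd (p j) else v))
        = (\<lambda>i. mom p i + e * f i v)"
        by (simp add: mom_def flip: lessThan_Suc_atMost)
      finally show ?thesis by (simp add: hh expand algebra_simps)
    qed
    then have "2 * (\<Sum>i\<in>I. h i * f i v) \<le> 0" by (intro nonpos_of_le_quadratic) auto
    then show ?thesis by simp
  qed
  \<comment> \<open>Minimality against shrinking the nearest point towards the apex of the cone.\<close>
  have hu: "0 \<le> (\<Sum>i\<in>I. h i * mom p i)"
  proof -
    have "- 2 * (\<Sum>i\<in>I. h i * mom p i) * e \<le> (\<Sum>i\<in>I. (mom p i)\<^sup>2) * e\<^sup>2" if "0 < e" "e < 1" for e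
    proof -
      have "q (mom p) \<le> q (\<lambda>i. \<Sum>j\<in>{..<N}. ((1 - e) * fst (p j)) * f i (snd (p j)))"
        using pw pV that by (intro min) auto
      also have "(\<lambda>i. \<Sum>j\<in>{..<N}. ((1 - e) * fst (p j)) * f i (snd (p j))) = (\<lambda>i. mom p i + (- e) * mom p i)"
        by (simp add: mom_def sum_distrib_left left_diff_distrib sum_subtractf sum_negf mult.assoc)
      finally show ?thesis unfolding hh expand by (simp add: algebra_simps)
    qed
    then have "- 2 * (\<Sum>i\<in>I. h i * mom p i) \<le> 0" by (intro nonpos_of_le_quadratic) auto
    then show ?thesis by simp
  qed
  show ?thesis
  proof (cases "hh = 0")
    case True
    then have "\<forall>i\<in>I. h i = 0" using I by (simp add: hh_def sum_nonneg_eq_0_iff)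
    then have "\<forall>i\<in>I. y i = (\<Sum>j<card I. fst (p j) * f i (snd (p j)))"
      by (simp add: h_def mom_def N_def)
    then show ?thesis using pw pV
      by (intro disjI1 exI[of _ "\<lambda>j. fst (p j)"] exI[of _ "\<lambda>j. snd (p j)"]) auto
  next
    case False
    then have "0 < hh" by (simp add: hh_def sum_nonneg less_le)
    moreover have "(\<Sum>i\<in>I. h i * y i) = hh + (\<Sum>i\<in>I. h i * mom p i)"
      by (simp add: hh_def h_def power2_eq_square algebra_simps flip: sum.distrib)
    ultimately have "(\<Sum>i\<in>I. h i * y i) > 0" using hu by linarith
    then show ?thesis using hV by blast
  qed
qed

section \<open>Homogeneous polynomials\<close>

lemma mpow_scaleR: "mpow (c *\<^sub>R x) \<alpha> = c ^ mdeg \<alpha> * mpow x \<alpha>"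
  by (simp add: mpow_def mdeg_def power_mult_distrib prod.distrib power_sum)

lemma continuous_on_mpow: "continuous_on S (\<lambda>x. mpow x \<alpha>)"
  unfolding mpow_def by (intro continuous_intros)

lemma finite_mdeg_le: "finite {\<alpha> :: 'n::finite \<Rightarrow> nat. mdeg \<alpha> \<le> d}"
proof (rule finite_subset)
  show "{\<alpha> :: 'n \<Rightarrow> nat. mdeg \<alpha> \<le> d} \<subseteq> PiE UNIV (\<lambda>_. {..d})"
  proof
    fix \<alpha> :: "'n \<Rightarrow> nat" assume "\<alpha> \<in> {\<alpha>. mdeg \<alpha> \<le> d}"
    then have "\<alpha> i \<le> d" for i
      using member_le_sum[of i UNIV \<alpha>] by (simp add: mdeg_def)
    then show "\<alpha> \<in> PiE UNIV (\<lambda>_. {..d})" by auto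
  qed
qed (intro finite_PiE, auto)

lemma finite_mdeg_eq: "finite {\<alpha> :: 'n::finite \<Rightarrow> nat. mdeg \<alpha> = d}"
  by (rule finite_subset[OF _ finite_mdeg_le[of d]]) auto

text \<open>
  Stars and bars, transported along an enumeration of the index type.
\<close>

lemma card_mdeg_eq: "card {\<alpha> :: 'n::finite \<Rightarrow> nat. mdeg \<alpha> = d} = (CARD('n) + d - 1) choose d"
proof -
  obtain xs :: "'n list" where xs: "set xs = UNIV" "distinct xs"
    using finite_distinct_list[of "UNIV :: 'n set"] by auto
  have len: "length xs = CARD('n)" using xs by (metis distinct_card)
  have inj: "inj (\<lambda>\<alpha> :: 'n \<Rightarrow> nat. map \<alpha> xs)"
    by (rule injI) (use xs in \<open>auto simp: map_eq_conv fun_eq_iff\<close>)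
  have img: "(\<lambda>\<alpha>. map \<alpha> xs) ` {\<alpha> :: 'n \<Rightarrow> nat. mdeg \<alpha> = d} = {l :: nat list. length l = CARD('n) \<and> sum_list l = d}"
  proof (intro equalityI subsetI)
    fix l assume "l \<in> (\<lambda>\<alpha>. map \<alpha> xs) ` {\<alpha> :: 'n \<Rightarrow> nat. mdeg \<alpha> = d}"
    then show "l \<in> {l :: nat list. length l = CARD('n) \<and> sum_list l = d}"
      using xs by (auto simp: len mdeg_def sum_list_distinct_conv_sum_set)
  next
    fix l :: "nat list" assume l: "l \<in> {l. length l = CARD('n) \<and> sum_list l = d}"
    define \<alpha> where "\<alpha> x = the (map_of (zip xs l) x)" for x
    have "map \<alpha> xs = l"
    proof (rule nth_equalityI)
      fix i assume "i < length (map \<alpha> xs)"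
      then show "map \<alpha> xs ! i = l ! i"
        using l len xs by (simp add: \<alpha>_def map_of_zip_nth)
    qed (use l len in auto)
    moreover from this have "mdeg \<alpha> = d"
      using l xs sum_list_distinct_conv_sum_set[of xs \<alpha>] by (simp add: mdeg_def)
    ultimately show "l \<in> (\<lambda>\<alpha>. map \<alpha> xs) ` {\<alpha> :: 'n \<Rightarrow> nat. mdeg \<alpha> = d}" by auto
  qed
  have "card {\<alpha> :: 'n \<Rightarrow> nat. mdeg \<alpha> = d} = card ((\<lambda>\<alpha>. map \<alpha> xs) ` {\<alpha> :: 'n \<Rightarrow> nat. mdeg \<alpha> = d})"
    using inj by (intro card_image[symmetric]) (auto intro: inj_on_subset)
  also have "\<dots> = (d + CARD('n) - 1) choose d" by (simp only: img card_length_sum_list)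
  finally show ?thesis by (simp add: add.commute)
qed

definition monomial_span :: "('n::finite \<Rightarrow> nat) set \<Rightarrow> (real ^ 'n \<Rightarrow> real) set" where
  "monomial_span A = {p. \<exists>c. \<forall>x. p x = (\<Sum>\<alpha>\<in>A. c \<alpha> * mpow x \<alpha>)}"

lemma hom_polys_span: "hom_polys d = monomial_span {\<alpha>. mdeg \<alpha> = d}"
  by (simp add: hom_polys_def monomial_span_def)

lemma polys_le_span: "polys_le d = monomial_span {\<alpha>. mdeg \<alpha> \<le> d}"
  by (simp add: polys_le_def monomial_span_def)

lemma monomial_span_monomial:
  fixes \<alpha> :: "'n::finite \<Rightarrow> nat"
  assumes "finite A" "\<alpha> \<in> A"
  shows "(\<lambda>x. mpow x \<alpha>) \<in> monomial_span A"
proof -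
  have "mpow x \<alpha> = (\<Sum>\<beta>\<in>A. of_bool (\<beta> = \<alpha>) * mpow x \<beta>)" for x :: "real ^ 'n"
    using assms by (simp add: of_bool_def if_distrib[of "\<lambda>u. u * _"] cong: if_cong)
  then show ?thesis unfolding monomial_span_def by (intro CollectI exI[of _ "\<lambda>\<beta>. of_bool (\<beta> = \<alpha>)"] allI)
qed

lemma monomial_span_add:
  assumes "p \<in> monomial_span A" "q \<in> monomial_span A"
  shows "(\<lambda>x. p x + q x) \<in> monomial_span A"
proof -
  obtain c e where "p = (\<lambda>x. \<Sum>\<alpha>\<in>A. c \<alpha> * mpow x \<alpha>)" "q = (\<lambda>x. \<Sum>\<alpha>\<in>A. e \<alpha> * mpow x \<alpha>)"
    using assms unfolding monomial_span_def by blast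
  then have "p x + q x = (\<Sum>\<alpha>\<in>A. (c \<alpha> + e \<alpha>) * mpow x \<alpha>)" for x
    by (simp add: distrib_right sum.distrib)
  then show ?thesis unfolding monomial_span_def by (intro CollectI exI[of _ "\<lambda>\<alpha>. c \<alpha> + e \<alpha>"]) auto
qed

lemma monomial_span_scale:
  assumes "p \<in> monomial_span A"
  shows "(\<lambda>x. r * p x) \<in> monomial_span A"
proof -
  obtain c where "p = (\<lambda>x. \<Sum>\<alpha>\<in>A. c \<alpha> * mpow x \<alpha>)"
    using assms unfolding monomial_span_def by blast
  then have "r * p x = (\<Sum>\<alpha>\<in>A. (r * c \<alpha>) * mpow x \<alpha>)" for x
    by (simp add: sum_distrib_left mult.assoc)
  then show ?thesis unfolding monomial_span_def by (intro CollectI exI[of _ "\<lambda>\<alpha>. r * c \<alpha>"]) auto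
qed

lemma monomial_span_sum:
  assumes "\<And>j. j \<in> J \<Longrightarrow> p j \<in> monomial_span A"
  shows "(\<lambda>x. \<Sum>j\<in>J. p j x) \<in> monomial_span A"
proof (cases "finite J")
  case True
  then show ?thesis using assms
  proof (induction J)
    case empty
    show ?case by (auto simp: monomial_span_def intro: exI[of _ "\<lambda>_. 0"])
  next
    case (insert j J)
    then show ?case by (simp add: monomial_span_add)
  qed
next
  case False
  then show ?thesis by (auto simp: monomial_span_def intro: exI[of _ "\<lambda>_. 0"])
qed

lemma continuous_on_monomial_span:
  assumes "p \<in> monomial_span A"
  shows "continuous_on S p"
proof -
  obtain c where "p = (\<lambda>x. \<Sum>\<alpha>\<in>A. c \<alpha> * mpow x \<alpha>)"
    using assms unfolding monomial_span_def by blast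
  then show ?thesis by (auto intro!: continuous_intros continuous_on_mpow)
qed

lemma polys_le_mult:
  assumes "p \<in> polys_le m" "q \<in> polys_le k"
  shows "(\<lambda>x. p x * q x) \<in> (polys_le (m + k) :: (real ^ 'n::finite \<Rightarrow> real) set)"
proof -
  obtain c e where p: "p = (\<lambda>x. \<Sum>\<alpha> | mdeg \<alpha> \<le> m. c \<alpha> * mpow x \<alpha>)"
    and q: "q = (\<lambda>x. \<Sum>\<beta> | mdeg \<beta> \<le> k. e \<beta> * mpow x \<beta>)"
    using assms unfolding polys_le_def by blast
  have "p x * q x = (\<Sum>\<alpha> | mdeg \<alpha> \<le> m. \<Sum>\<beta> | mdeg \<beta> \<le> k. (c \<alpha> * e \<beta>) * mpow x (\<lambda>i. \<alpha> i + \<beta> i))" for x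
    by (simp add: p q sum_product mpow_def power_add prod.distrib mult_ac)
  moreover have "(\<lambda>x :: real ^ 'n. \<Sum>\<alpha> | mdeg \<alpha> \<le> m. \<Sum>\<beta> | mdeg \<beta> \<le> k. (c \<alpha> * e \<beta>) * mpow x (\<lambda>i. \<alpha> i + \<beta> i))
      \<in> polys_le (m + k)"
    unfolding polys_le_span
    by (intro monomial_span_sum monomial_span_scale monomial_span_monomial finite_mdeg_le)
      (auto simp: mdeg_def sum.distrib)
  ultimately show ?thesis by presburger
qed

lemma polys_le_const: "(\<lambda>x. r) \<in> polys_le k"
proof -
  have "(\<lambda>x. r * mpow x (\<lambda>_. 0)) \<in> polys_le k"
    unfolding polys_le_span
    by (intro monomial_span_scale monomial_span_monomial finite_mdeg_le) (simp add: mdeg_def)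
  then show ?thesis by (simp add: mpow_def)
qed

lemma polys_le_coordinate_diff: "(\<lambda>x :: real ^ 'n::finite. (x - a) $ i) \<in> polys_le 1"
proof -
  have "mpow x (\<lambda>j. of_bool (j = i)) = x $ i" for x :: "real ^ 'n"
    by (simp add: mpow_def of_bool_def if_distrib[of "\<lambda>u. _ ^ u"] cong: if_cong)
  moreover have "(\<lambda>x :: real ^ 'n. mpow x (\<lambda>j. of_bool (j = i))) \<in> polys_le 1"
    unfolding polys_le_span by (intro monomial_span_monomial finite_mdeg_le) (simp add: mdeg_def)
  ultimately have "(\<lambda>x :: real ^ 'n. x $ i) \<in> polys_le 1" by simp
  then have "(\<lambda>x :: real ^ 'n. x $ i + (- (a $ i))) \<in> polys_le 1"
    using polys_le_const[of "- (a $ i)" 1] unfolding polys_le_span by (intro monomial_span_add)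
  then show ?thesis by simp
qed

lemma polys_le_mpow_translate: "(\<lambda>x :: real ^ 'n::finite. mpow (x - a) \<alpha>) \<in> polys_le (mdeg \<alpha>)"
proof -
  have pow: "(\<lambda>x :: real ^ 'n. ((x - a) $ i) ^ k) \<in> polys_le k" for i k
  proof (induction k)
    case 0
    then show ?case by (simp add: polys_le_const)
  next
    case (Suc k)
    then show ?case using polys_le_mult[OF polys_le_coordinate_diff Suc] by simp
  qed
  have "(\<lambda>x :: real ^ 'n. \<Prod>i\<in>A. ((x - a) $ i) ^ \<alpha> i) \<in> polys_le (\<Sum>i\<in>A. \<alpha> i)" if "finite A" for A
    using that
  proof (induction A)
    case empty
    then show ?case by (simp add: polys_le_const)
  next
    case (insert i A)
    then show ?case using polys_le_mult[OF pow insert.IH] by simp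
  qed
  from this[of UNIV] show ?thesis by (simp add: mpow_def mdeg_def)
qed

lemma hom_polys_translate_le:
  assumes "g \<in> hom_polys d"
  shows "(\<lambda>x. 1 - g (x - a)) \<in> (polys_le d :: (real ^ 'n::finite \<Rightarrow> real) set)"
proof -
  obtain c where g: "g = (\<lambda>x. \<Sum>\<alpha> | mdeg \<alpha> = d. c \<alpha> * mpow x \<alpha>)"
    using assms unfolding hom_polys_def by blast
  have "(\<lambda>x. 1 + (\<Sum>\<alpha> | mdeg \<alpha> = d. (- c \<alpha>) * mpow (x - a) \<alpha>)) \<in> (polys_le d :: (real ^ 'n \<Rightarrow> real) set)"
    unfolding polys_le_span
    by (intro monomial_span_add monomial_span_sum monomial_span_scale)
      (use polys_le_const polys_le_mpow_translate in \<open>auto simp flip: polys_le_span\<close>)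
  then show ?thesis by (simp add: g sum_negf)
qed

lemma hom_polys_scaleR:
  assumes "g \<in> hom_polys d"
  shows "g (c *\<^sub>R x) = c ^ d * g x"
proof -
  obtain e where "g = (\<lambda>x. \<Sum>\<alpha> | mdeg \<alpha> = d. e \<alpha> * mpow x \<alpha>)"
    using assms unfolding hom_polys_def by blast
  then show ?thesis by (simp add: mpow_scaleR sum_distrib_left mult_ac)
qed

text \<open>
  On the line from the centre \<open>w\<close> through \<open>x\<close>, both sides are univariate polynomials that agree
  on a whole interval.
\<close>

lemma monomial_span_eq_if_eq_on_ball:
  fixes p q :: "real ^ 'n::finite \<Rightarrow> real"
  assumes "p \<in> monomial_span A" "q \<in> monomial_span A" and r: "r > 0"
    and eq: "\<And>x. x \<in> ball w r \<Longrightarrow> p x = q x"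
  shows "p x = q x"
proof -
  have line: "\<exists>P. \<forall>t. p (w + t *\<^sub>R (x - w)) = poly P t" if p: "p \<in> monomial_span A"
    for p :: "real ^ 'n \<Rightarrow> real"
  proof -
    obtain c where c: "p = (\<lambda>x. \<Sum>\<alpha>\<in>A. c \<alpha> * mpow x \<alpha>)"
      using p unfolding monomial_span_def by blast
    show ?thesis
      by (rule exI[of _ "\<Sum>\<alpha>\<in>A. smult (c \<alpha>) (\<Prod>i\<in>UNIV. [: w $ i, (x - w) $ i :] ^ \<alpha> i)"])
        (simp add: c mpow_def poly_sum poly_prod)
  qed
  obtain P Q where P: "\<And>t. p (w + t *\<^sub>R (x - w)) = poly P t"
    and Q: "\<And>t. q (w + t *\<^sub>R (x - w)) = poly Q t"
    using line assms by metis
  \<comment> \<open>For \<open>0 < t < e\<close> the point \<open>w + t (x - w)\<close> is still in the ball.\<close>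
  define e where "e = r / (norm (x - w) + 1)"
  have e: "e > 0" using r by (simp add: e_def add_nonneg_pos)
  have "poly (P - Q) t = 0" if "t \<in> {0<..<e}" for t
  proof -
    have "norm (x - w) * t \<le> norm (x - w) * e" using that by (intro mult_left_mono) auto
    also have "\<dots> < (norm (x - w) + 1) * e" using e by (intro mult_strict_right_mono) auto
    also have "\<dots> = r" unfolding e_def
      by (metis add_nonneg_pos less_numeral_extra(1) nonzero_mult_div_cancel_left norm_ge_zero
          order_less_irrefl times_divide_eq_right)
    finally have "w + t *\<^sub>R (x - w) \<in> ball w r" using that by (simp add: dist_norm mult.commute)
    then show ?thesis using eq P Q by (metis diff_self poly_diff)
  qed
  then have "{0<..<e} \<subseteq> {t. poly (P - Q) t = 0}" by blast
  then have "infinite {t. poly (P - Q) t = 0}" using e by (meson infinite_Ioo infinite_super)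
  then have "P - Q = 0" using poly_roots_finite by blast
  then show ?thesis using P[of 1] Q[of 1] by simp
qed

lemma hom_polys_add_scaled:
  assumes "g \<in> hom_polys d" "h \<in> hom_polys d"
  shows "(\<lambda>x. g x + t * h x) \<in> hom_polys d"
  using assms unfolding hom_polys_span by (intro monomial_span_add monomial_span_scale)

lemma hom_polys_scale: "g \<in> hom_polys d \<Longrightarrow> (\<lambda>x. t * g x) \<in> hom_polys d"
  unfolding hom_polys_span by (rule monomial_span_scale)

lemma continuous_on_hom_polys: "g \<in> hom_polys d \<Longrightarrow> continuous_on S g"
  unfolding hom_polys_span by (rule continuous_on_monomial_span)

lemma borel_measurable_hom_polys: "g \<in> hom_polys d \<Longrightarrow> g \<in> borel_measurable borel"
  by (intro borel_measurable_continuous_onI continuous_on_hom_polys)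

lemma sets_borel_sublevel:
  assumes "g \<in> hom_polys d"
  shows "{x. g x \<le> t} \<in> sets borel" "{x. g x < t} \<in> sets borel"
proof -
  have [measurable]: "g \<in> borel_measurable borel" by (rule borel_measurable_hom_polys[OF assms])
  show "{x. g x \<le> t} \<in> sets borel" "{x. g x < t} \<in> sets borel" by measurable
qed

text \<open>
  The nodes can be chosen in any prescribed ball, because agreement on a ball forces agreement
  everywhere. Pointwise bounds on a ball thereby control the polynomial as a whole, which replaces
  a comparison of norms on the space of forms.
\<close>

lemma hom_polys_interpolation:
  fixes w :: "real ^ 'n::finite"
  assumes r: "r > 0"
  shows "\<exists>X L. finite X \<and> X \<subseteq> ball w r \<and> (\<forall>x\<in>X. L x \<in> hom_polys d)
    \<and> (\<forall>g\<in>hom_polys d. \<forall>y. g y = (\<Sum>x\<in>X. g x * L x y))"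
proof -
  obtain X L where X: "finite X" "X \<subseteq> ball w r"
    and span: "\<forall>x\<in>X. \<exists>c. \<forall>s. L x s = (\<Sum>\<alpha> | mdeg \<alpha> = d. c \<alpha> * mpow s \<alpha>)"
    and rep: "\<forall>\<alpha>\<in>{\<alpha>. mdeg \<alpha> = d}. \<forall>s\<in>ball w r. mpow s \<alpha> = (\<Sum>x\<in>X. mpow x \<alpha> * L x s)"
    using interpolation_nodes[OF finite_mdeg_eq[of d], of "ball w r" "\<lambda>\<alpha> x. mpow x \<alpha>"]
    by (elim exE conjE) (rule that)
  have L: "L x \<in> hom_polys d" if "x \<in> X" for x
    using span that by (simp add: hom_polys_def)
  have rep_g: "g y = (\<Sum>x\<in>X. g x * L x y)" if g: "g \<in> hom_polys d" for g y
  proof (rule monomial_span_eq_if_eq_on_ball[OF _ _ r])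
    show "g \<in> monomial_span {\<alpha>. mdeg \<alpha> = d}" using g by (simp add: hom_polys_span)
    show "(\<lambda>y. \<Sum>x\<in>X. g x * L x y) \<in> monomial_span {\<alpha>. mdeg \<alpha> = d}"
      using L by (intro monomial_span_sum monomial_span_scale) (simp add: hom_polys_span)
    fix y assume y: "y \<in> ball w r"
    obtain c where c: "g = (\<lambda>x. \<Sum>\<alpha> | mdeg \<alpha> = d. c \<alpha> * mpow x \<alpha>)"
      using g unfolding hom_polys_def by blast
    have "g y = (\<Sum>\<alpha> | mdeg \<alpha> = d. c \<alpha> * mpow y \<alpha>)" by (simp only: c)
    also have "\<dots> = (\<Sum>\<alpha> | mdeg \<alpha> = d. c \<alpha> * (\<Sum>x\<in>X. mpow x \<alpha> * L x y))"
    proof (rule sum.cong[OF refl])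
      fix \<alpha> :: "'n \<Rightarrow> nat" assume "\<alpha> \<in> {\<alpha>. mdeg \<alpha> = d}"
      from bspec[OF bspec[OF rep this] y]
      show "c \<alpha> * mpow y \<alpha> = c \<alpha> * (\<Sum>x\<in>X. mpow x \<alpha> * L x y)" by (rule arg_cong)
    qed
    also have "\<dots> = (\<Sum>x\<in>X. \<Sum>\<alpha> | mdeg \<alpha> = d. c \<alpha> * (mpow x \<alpha> * L x y))"
      by (simp only: sum_distrib_left, rule sum.swap)
    also have "\<dots> = (\<Sum>x\<in>X. g x * L x y)"
      by (simp add: c sum_distrib_right mult.assoc)
    finally show "g y = (\<Sum>x\<in>X. g x * L x y)" .
  qed
  show ?thesis
    by (rule exI[of _ X], rule exI[of _ L]) (intro conjI X ballI L allI rep_g)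
qed

section \<open>Sublevel volumes and the integral of the exponential\<close>

lemma emeasure_lebesgue_scaled:
  fixes S :: "(real ^ 'n::finite) set"
  assumes "s \<ge> 0"
  shows "emeasure lebesgue ((*\<^sub>R) s ` S) = ennreal (s ^ CARD('n)) * emeasure lebesgue S"
  using emeasure_lebesgue_affine[of s 0 S] assms by (simp add: ennreal_power)

lemma emeasure_lebesgue_translated:
  fixes S :: "(real ^ 'n::finite) set"
  shows "emeasure lebesgue {x. x - a \<in> S} = emeasure lebesgue S"
proof -
  have "{x. x - a \<in> S} = (\<lambda>x. 1 *\<^sub>R x + a) ` S"
    by (auto simp: image_iff intro!: bexI[of _ "_ - a"])
  then show ?thesis using emeasure_lebesgue_affine[of 1 a S] by simp
qed

lemma objective_eq: "objective a g = emeasure lebesgue {x. g x \<le> 1}"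
  using emeasure_lebesgue_translated[of a "{x. g x \<le> 1}"] by (simp add: objective_def)

text \<open>
  Otherwise \<open>{g < 0}\<close> would be a nonempty open cone inside the sublevel set, invariant under
  doubling; its volume \<open>v\<close> would be positive and finite with \<open>v = 2\<^sup>n v\<close>.
\<close>

lemma finvol_polys_nonneg:
  fixes g :: "real ^ 'n::finite \<Rightarrow> real"
  assumes g: "g \<in> finvol_polys d"
  shows "g x \<ge> 0"
proof (rule ccontr)
  assume "\<not> g x \<ge> 0"
  define U where "U = {x. g x < 0}"
  have hom: "g \<in> hom_polys d" and fin: "emeasure lebesgue {x. g x \<le> 1} < \<infinity>"
    using g by (auto simp: finvol_polys_def)
  have "open U" unfolding U_def
    using continuous_on_hom_polys[OF hom] by (intro open_Collect_less) auto
  moreover have "U \<noteq> {}" using \<open>\<not> g x \<ge> 0\<close> unfolding U_def not_le by blast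
  ultimately have pos: "emeasure lebesgue U > 0"
    using open_not_negligible[OF \<open>open U\<close>] \<open>open U\<close>
    by (auto simp: negligible_iff_null_sets null_sets_def zero_less_iff_neq_zero)
  have "emeasure lebesgue U \<le> emeasure lebesgue {x. g x \<le> 1}"
    using sets_borel_sublevel[OF hom] by (intro emeasure_mono) (auto simp: U_def)
  then have finU: "emeasure lebesgue U < \<infinity>" using fin by (rule le_less_trans)
  have "(*\<^sub>R) 2 ` U = U"
  proof (intro equalityI subsetI)
    fix y assume "y \<in> U"
    then have "(1/2) *\<^sub>R y \<in> U" by (auto simp: U_def hom_polys_scaleR[OF hom] mult_pos_neg)
    then show "y \<in> (*\<^sub>R) 2 ` U" by (intro image_eqI[of _ _ "(1/2) *\<^sub>R y"]) auto
  next
    fix y assume "y \<in> (*\<^sub>R) 2 ` U"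
    then show "y \<in> U" by (auto simp: U_def hom_polys_scaleR[OF hom] mult_pos_neg)
  qed
  then have "emeasure lebesgue U = ennreal (2 ^ CARD('n)) * emeasure lebesgue U"
    using emeasure_lebesgue_scaled[of 2 U] by simp
  moreover obtain v where v: "emeasure lebesgue U = ennreal v" "v \<ge> 0"
    using finU by (cases "emeasure lebesgue U") auto
  ultimately have "v = 2 ^ CARD('n) * v" by (simp flip: ennreal_mult)
  moreover have "(2::real) ^ CARD('n) > 1" by (intro one_less_power) auto
  ultimately show False using pos v by auto
qed

lemma emeasure_sublevel:
  fixes g :: "real ^ 'n::finite \<Rightarrow> real"
  assumes g: "g \<in> hom_polys d" and "d > 0" "t > 0"
  shows "emeasure lebesgue {x. g x \<le> t} = ennreal (t powr (real CARD('n) / d)) * emeasure lebesgue {x. g x \<le> 1}"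
proof -
  define s where "s = t powr (1 / d)"
  have s: "s > 0" "s ^ d = t" using assms by (auto simp: s_def powr_powr simp flip: powr_realpow)
  have "{x. g x \<le> t} = (*\<^sub>R) s ` {x. g x \<le> 1}"
  proof (intro equalityI subsetI)
    fix y assume "y \<in> {x. g x \<le> t}"
    then have "g ((1/s) *\<^sub>R y) \<le> 1"
      using s \<open>t > 0\<close> by (simp add: hom_polys_scaleR[OF g] power_divide)
    then show "y \<in> (*\<^sub>R) s ` {x. g x \<le> 1}" using s by (intro image_eqI[of _ _ "(1/s) *\<^sub>R y"]) auto
  next
    fix y assume "y \<in> (*\<^sub>R) s ` {x. g x \<le> 1}"
    then show "y \<in> {x. g x \<le> t}" using s \<open>t > 0\<close> by (auto simp: hom_polys_scaleR[OF g])
  qed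
  moreover have "s ^ CARD('n) = t powr (real CARD('n) / d)"
    using assms by (simp add: s_def powr_powr flip: powr_realpow)
  ultimately show ?thesis using emeasure_lebesgue_scaled[of s "{x. g x \<le> 1}"] s by simp
qed

lemma nn_integral_exp_tail: "(\<integral>\<^sup>+t. ennreal (exp (- t)) * indicator {a..} t \<partial>lborel) = ennreal (exp (- a))"
proof -
  have "((\<lambda>t::real. - exp (- t)) \<longlongrightarrow> - 0) at_top"
    by (intro tendsto_minus filterlim_compose[OF exp_at_bot] filterlim_uminus_at_bot_at_top)
  then have "(\<integral>\<^sup>+t. ennreal (exp (- t)) * indicator {a..} t \<partial>lborel) = ennreal (0 - (- exp (- a)))"
    by (intro nn_integral_FTC_atLeast) (auto intro!: derivative_eq_intros)
  then show ?thesis by simp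
qed

text \<open>
  Since \<open>exp (- g x)\<close> is the integral of \<open>exp (- t)\<close> over \<open>t \<ge> g x\<close>, Tonelli turns the left-hand
  side into the integral of \<open>exp (- t) vol {g \<le> t}\<close>, and homogeneity makes
  \<open>vol {g \<le> t} = t\<^bsup>n/d\<^esup> vol {g \<le> 1}\<close>, leaving a Gamma integral.
\<close>

lemma nn_integral_exp_neg:
  fixes g :: "real ^ 'n::finite \<Rightarrow> real"
  assumes g: "g \<in> hom_polys d" and d: "d > 0" and nonneg: "\<And>x. g x \<ge> 0"
  shows "(\<integral>\<^sup>+x. ennreal (exp (- g x)) \<partial>lborel)
    = ennreal (Gamma (1 + real CARD('n) / d)) * emeasure lebesgue {x. g x \<le> 1}"
proof -
  define vol where "vol = emeasure lebesgue {x. g x \<le> 1}"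
  have [measurable]: "g \<in> borel_measurable borel" by (rule borel_measurable_hom_polys[OF g])
  have "{p \<in> space (borel \<Otimes>\<^sub>M borel). g (snd p) \<le> fst p} \<in> sets (borel \<Otimes>\<^sub>M borel)" by measurable
  then have [measurable]: "{p. g (snd p) \<le> fst p} \<in> sets (borel \<Otimes>\<^sub>M borel)" by (simp add: space_pair_measure)
  have slice: "(\<integral>\<^sup>+x. ennreal (exp (- t)) * indicator {g x..} t \<partial>lborel)
      = ennreal (indicator {0..} t * t powr (1 + real CARD('n) / d - 1) / exp t) * vol"
    if "t \<noteq> 0" for t
  proof (cases "t > 0")
    case True
    have "(\<integral>\<^sup>+x. ennreal (exp (- t)) * indicator {g x..} t \<partial>lborel)
        = (\<integral>\<^sup>+x. ennreal (exp (- t)) * indicator {x. g x \<le> t} x \<partial>lborel)"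
      by (intro nn_integral_cong) (auto split: split_indicator)
    also have "\<dots> = ennreal (exp (- t)) * emeasure lborel {x. g x \<le> t}"
      by (simp add: nn_integral_cmult_indicator)
    also have "emeasure lborel {x. g x \<le> t} = ennreal (t powr (real CARD('n) / d)) * vol"
      using emeasure_sublevel[OF g d True] sets_borel_sublevel[OF g] by (simp add: vol_def)
    also have "ennreal (exp (- t)) * (ennreal (t powr (real CARD('n) / d)) * vol)
        = ennreal (exp (- t) * t powr (real CARD('n) / d)) * vol"
      by (simp only: ennreal_mult' exp_ge_zero mult.assoc)
    also have "exp (- t) * t powr (real CARD('n) / d) = t powr (real CARD('n) / d) / exp t"
      by (simp add: exp_minus divide_inverse)
    finally show ?thesis using True by simp
  next
    case False
    then have "t < g x" for x using that nonneg[of x] by linarith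
    then have "indicator {g x..} t = (0 :: ennreal)" for x by (auto simp: indicator_def not_le)
    then show ?thesis using False that by simp
  qed
  have "(\<integral>\<^sup>+x. ennreal (exp (- g x)) \<partial>lborel)
      = (\<integral>\<^sup>+x. \<integral>\<^sup>+t. ennreal (exp (- t)) * indicator {g x..} t \<partial>lborel \<partial>lborel)"
    by (simp add: nn_integral_exp_tail)
  also have "\<dots> = (\<integral>\<^sup>+t. \<integral>\<^sup>+x. ennreal (exp (- t)) * indicator {g x..} t \<partial>lborel \<partial>lborel)"
  proof (rule lborel_pair.Fubini'[of "\<lambda>t x. ennreal (exp (- t)) * indicator {g x..} t"])
    have "(\<lambda>(t, x). ennreal (exp (- t)) * indicator {g x..} t)
        = (\<lambda>p. ennreal (exp (- fst p)) * indicator {p. g (snd p) \<le> fst p} p)"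
      by (auto simp: fun_eq_iff split: split_indicator)
    then show "(\<lambda>(t, x). ennreal (exp (- t)) * indicator {g x..} t) \<in> borel_measurable (lborel \<Otimes>\<^sub>M lborel)"
      by simp
  qed
  also have "\<dots> = (\<integral>\<^sup>+t. ennreal (indicator {0..} t * t powr (1 + real CARD('n) / d - 1) / exp t) * vol \<partial>lborel)"
  proof (rule nn_integral_cong_AE)
    show "AE t in lborel. (\<integral>\<^sup>+x. ennreal (exp (- t)) * indicator {g x..} t \<partial>lborel)
        = ennreal (indicator {0..} t * t powr (1 + real CARD('n) / d - 1) / exp t) * vol"
      using AE_lborel_singleton[of "0::real"] by eventually_elim (rule slice)
  qed
  also have "\<dots> = ennreal (Gamma (1 + real CARD('n) / d)) * vol"
    by (subst nn_integral_multc) (auto simp: Gamma_conv_nn_integral_real add_pos_nonneg)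
  finally show ?thesis by (simp add: vol_def)
qed

lemma finvol_polys_exp:
  fixes g :: "real ^ 'n::finite \<Rightarrow> real"
  assumes g: "g \<in> finvol_polys d" and d: "d > 0"
  shows "integrable lborel (\<lambda>x. exp (- g x))"
    and "ennreal (\<integral>x. exp (- g x) \<partial>lborel)
      = ennreal (Gamma (1 + real CARD('n) / d)) * emeasure lebesgue {x. g x \<le> 1}"
proof -
  have hom: "g \<in> hom_polys d" and fin: "emeasure lebesgue {x. g x \<le> 1} < \<infinity>"
    using g by (auto simp: finvol_polys_def)
  have [measurable]: "g \<in> borel_measurable borel" by (rule borel_measurable_hom_polys[OF hom])
  note eq = nn_integral_exp_neg[OF hom d finvol_polys_nonneg[OF g]]
  show int: "integrable lborel (\<lambda>x. exp (- g x))"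
    using fin by (intro integrableI_nonneg) (auto simp: eq ennreal_mult_less_top)
  show "ennreal (\<integral>x. exp (- g x) \<partial>lborel)
      = ennreal (Gamma (1 + real CARD('n) / d)) * emeasure lebesgue {x. g x \<le> 1}"
    using nn_integral_eq_integral[OF int] by (simp add: eq)
qed

lemma finvol_polys_exp_scaled:
  fixes g :: "real ^ 'n::finite \<Rightarrow> real"
  assumes g: "g \<in> finvol_polys d" and d: "d > 0" and s: "s > 0"
  shows "integrable lborel (\<lambda>x. exp (- (s * g x)))"
    and "(\<integral>x. exp (- (s * g x)) \<partial>lborel) = s powr (- (real CARD('n) / d)) * (\<integral>x. exp (- g x) \<partial>lborel)"
proof -
  have hom: "g \<in> hom_polys d" and fin: "emeasure lebesgue {x. g x \<le> 1} < \<infinity>"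
    using g by (auto simp: finvol_polys_def)
  have set: "{x. s * g x \<le> 1} = {x. g x \<le> 1 / s}" using s by (auto simp: field_simps)
  have vol: "emeasure lebesgue {x. s * g x \<le> 1}
      = ennreal (s powr (- (real CARD('n) / d))) * emeasure lebesgue {x. g x \<le> 1}"
  proof -
    have "(1 / s) powr p = s powr (- p)" for p :: real
      using powr_divide[of 1 s p] s by (simp only: powr_one_eq_one powr_minus inverse_eq_divide less_imp_le)
    moreover have "1 / s > 0" using s by simp
    ultimately show ?thesis using emeasure_sublevel[OF hom d, of "1 / s"] by (simp only: set)
  qed
  have sg: "(\<lambda>x. s * g x) \<in> finvol_polys d"
    using fin hom by (simp add: finvol_polys_def vol hom_polys_scale ennreal_mult_less_top)
  show "integrable lborel (\<lambda>x. exp (- (s * g x)))" by (rule finvol_polys_exp(1)[OF sg d])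
  have "ennreal (\<integral>x. exp (- (s * g x)) \<partial>lborel)
      = ennreal (s powr (- (real CARD('n) / d))) * ennreal (\<integral>x. exp (- g x) \<partial>lborel)"
    unfolding finvol_polys_exp(2)[OF sg d] finvol_polys_exp(2)[OF g d] vol by (rule mult.left_commute)
  also have "\<dots> = ennreal (s powr (- (real CARD('n) / d)) * (\<integral>x. exp (- g x) \<partial>lborel))"
    by (rule ennreal_mult'[symmetric]) simp
  finally have "ennreal (\<integral>x. exp (- (s * g x)) \<partial>lborel)
      = ennreal (s powr (- (real CARD('n) / d)) * (\<integral>x. exp (- g x) \<partial>lborel))" .
  then show "(\<integral>x. exp (- (s * g x)) \<partial>lborel) = s powr (- (real CARD('n) / d)) * (\<integral>x. exp (- g x) \<partial>lborel)"
    by (subst (asm) ennreal_inj) (auto intro!: mult_nonneg_nonneg integral_nonneg_AE)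
qed

text \<open>
  The integral of \<open>exp (- s g)\<close> equals \<open>s\<^bsup>-n/d\<^esup> \<phi>\<close> by scaling and dominates its tangent
  \<open>\<phi> - (s - 1) \<psi>\<close> by convexity. The difference of the two is minimal at \<open>s = 1\<close>, so its derivative
  there vanishes; differentiation under the integral sign is avoided.
\<close>

lemma euler_identity:
  fixes g :: "real ^ 'n::finite \<Rightarrow> real"
  assumes g: "g \<in> finvol_polys d" and d: "d > 0"
  shows "integrable lborel (\<lambda>x. g x * exp (- g x))"
    and "(\<integral>x. g x * exp (- g x) \<partial>lborel) = real CARD('n) / d * (\<integral>x. exp (- g x) \<partial>lborel)"
proof -
  have hom: "g \<in> hom_polys d" using g by (auto simp: finvol_polys_def)
  have [measurable]: "g \<in> borel_measurable borel" by (rule borel_measurable_hom_polys[OF hom])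
  note g0 = finvol_polys_nonneg[OF g]
  show int: "integrable lborel (\<lambda>x. g x * exp (- g x))"
  proof (rule Bochner_Integration.integrable_bound)
    show "integrable lborel (\<lambda>x. 2 * exp (- (1/2 * g x)))"
      using finvol_polys_exp_scaled(1)[OF g d, of "1/2"] by simp
    have "g x * exp (- g x) \<le> 2 * exp (- (1/2 * g x))" for x
    proof -
      \<comment> \<open>Half of the exponential decay absorbs the factor \<open>g x\<close>.\<close>
      have "g x / 2 \<le> exp (g x / 2)" using exp_ge_add_one_self[of "g x / 2"] by linarith
      then have "g x * exp (- g x) \<le> 2 * exp (g x / 2) * exp (- g x)" by (intro mult_right_mono) auto
      also have "\<dots> = 2 * exp (- (1/2 * g x))" by (simp flip: exp_add)
      finally show ?thesis .
    qed
    then show "AE x in lborel. norm (g x * exp (- g x)) \<le> norm (2 * exp (- (1/2 * g x)))"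
      using g0 by (intro AE_I2) (auto simp: abs_mult)
  qed measurable
  define \<phi> where "\<phi> = (\<integral>x. exp (- g x) \<partial>lborel)"
  define \<psi> where "\<psi> = (\<integral>x. g x * exp (- g x) \<partial>lborel)"
  define p where "p = real CARD('n) / d"
  \<comment> \<open>The gap between the integral of \<open>exp (- s g)\<close> and its tangent at \<open>s = 1\<close>, up to a constant.\<close>
  define F where "F s = s powr (- p) * \<phi> + (s - 1) * \<psi>" for s
  have "F 1 \<le> F s" if "s > 0" for s
  proof -
    have "exp (- g x) - (s - 1) * (g x * exp (- g x)) \<le> exp (- (s * g x))" for x
    proof -
      have "(1 - (s - 1) * g x) * exp (- g x) \<le> exp (- ((s - 1) * g x)) * exp (- g x)"
        using exp_ge_add_one_self[of "- ((s - 1) * g x)"] by (intro mult_right_mono) auto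
      also have "\<dots> = exp (- (s * g x))" by (simp add: algebra_simps flip: exp_add)
      finally show ?thesis by (simp add: algebra_simps)
    qed
    then have "(\<integral>x. exp (- g x) - (s - 1) * (g x * exp (- g x)) \<partial>lborel) \<le> (\<integral>x. exp (- (s * g x)) \<partial>lborel)"
      using finvol_polys_exp(1)[OF g d] int finvol_polys_exp_scaled(1)[OF g d that]
      by (intro integral_mono) auto
    then have "\<phi> - (s - 1) * \<psi> \<le> s powr (- p) * \<phi>"
      using finvol_polys_exp(1)[OF g d] int
      by (simp add: finvol_polys_exp_scaled(2)[OF g d that] \<phi>_def \<psi>_def p_def)
    then show ?thesis by (simp add: F_def)
  qed
  then have min: "\<forall>y. \<bar>1 - y\<bar> < 1 \<longrightarrow> F 1 \<le> F y" by (auto simp: abs_less_iff)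
  have "((\<lambda>s. s powr (- p)) has_real_derivative (- p) * 1 powr (- p - 1)) (at 1)"
    by (rule has_real_derivative_powr) simp
  then have "DERIV F 1 :> (- p) * 1 powr (- p - 1) * \<phi> + (1 - 0) * \<psi>"
    unfolding F_def[abs_def] by (intro DERIV_add DERIV_cmult_right DERIV_diff DERIV_ident DERIV_const)
  from DERIV_local_min[OF this _ min] have "\<psi> - p * \<phi> = 0" by simp
  then show "\<psi> = p * \<phi>" by simp
qed

text \<open>
  In the product topology a segment \<open>g + t h\<close> depends continuously on \<open>t\<close>, so interior points
  can be moved a little in both directions along any form.
\<close>

lemma int_finvol_polys_direction:
  fixes g h :: "real ^ 'n::finite \<Rightarrow> real"
  assumes g: "g \<in> int_finvol_polys d" and h: "h \<in> hom_polys d"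
  shows "\<exists>t0>0. \<forall>t. \<bar>t\<bar> \<le> t0 \<longrightarrow> (\<lambda>x. g x + t * h x) \<in> finvol_polys d"
proof -
  obtain U where U: "openin (top_of_set (hom_polys d)) U" "g \<in> U" "U \<subseteq> finvol_polys d"
    using g unfolding int_finvol_polys_def interior_of_def by blast
  then obtain W where W: "open W" "U = hom_polys d \<inter> W" by (auto simp: openin_open)
  have hom: "g \<in> hom_polys d" using U W by blast
  have "continuous_on UNIV (\<lambda>t x. g x + t * h x)"
    by (intro continuous_on_coordinatewise_then_product continuous_intros)
  then have "open ((\<lambda>t x. g x + t * h x) -` W)"
    by (rule open_vimage[OF W(1)])
  moreover have "0 \<in> (\<lambda>t x. g x + t * h x) -` W" using U W by simp
  ultimately obtain e where e: "e > 0" "cball 0 e \<subseteq> (\<lambda>t x. g x + t * h x) -` W"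
    by (meson open_contains_cball)
  have "(\<lambda>x. g x + t * h x) \<in> finvol_polys d" if "\<bar>t\<bar> \<le> e" for t
  proof -
    have "t \<in> cball 0 e" using that by simp
    then have "(\<lambda>x. g x + t * h x) \<in> W" using e(2) by (meson subsetD vimageD)
    then have "(\<lambda>x. g x + t * h x) \<in> U" using W(2) hom_polys_add_scaled[OF hom h] by simp
    then show ?thesis using U(3) by (rule subsetD[rotated])
  qed
  then show ?thesis using e(1) by (intro exI[of _ e]) simp
qed

lemma int_finvol_polys_imp: "g \<in> int_finvol_polys d \<Longrightarrow> g \<in> finvol_polys d"
  unfolding int_finvol_polys_def by (rule subsetD[OF interior_of_subset])

section \<open>Existence of an optimal solution\<close>

lemma convergent_subsequence_on_finite_set:
  fixes G :: "nat \<Rightarrow> 'a \<Rightarrow> real"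
  assumes "finite X" and bound: "\<And>k x. x \<in> X \<Longrightarrow> \<bar>G k x\<bar> \<le> B"
  shows "\<exists>l s. strict_mono (s :: nat \<Rightarrow> nat) \<and> (\<forall>x\<in>X. (\<lambda>k. G (s k) x) \<longlonglongrightarrow> l x)"
proof -
  have bdd: "bounded ((\<lambda>f. f x) ` range G)" if "x \<in> X" for x
    by (rule boundedI[of _ B]) (use bound that in auto)
  have "\<forall>D\<subseteq>X. \<exists>l. \<exists>s::nat\<Rightarrow>nat. strict_mono s \<and>
      (\<forall>e>0. eventually (\<lambda>k. \<forall>x\<in>D. dist (G (s k) x) (l x) < e) sequentially)"
    by (rule compact_lemma_general[of X "\<lambda>f x. f x" G "\<lambda>f. f"]) (use assms(1) bdd in auto)
  then obtain l and s :: "nat \<Rightarrow> nat" where s: "strict_mono s"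
    and ev: "\<And>e. e > 0 \<Longrightarrow> eventually (\<lambda>k. \<forall>x\<in>X. dist (G (s k) x) (l x) < e) sequentially"
    by blast
  have "(\<lambda>k. G (s k) x) \<longlonglongrightarrow> l x" if "x \<in> X" for x
  proof (rule tendstoI)
    fix e :: real assume "e > 0"
    from ev[OF this] show "eventually (\<lambda>k. dist (G (s k) x) (l x) < e) sequentially"
      by (rule eventually_mono) (use that in blast)
  qed
  then show ?thesis using s by blast
qed

lemma feasibleD:
  assumes "feasible K d a g"
  shows "g \<in> finvol_polys d" "g \<in> hom_polys d" "\<And>x. g x \<ge> 0" "\<And>x. x \<in> K \<Longrightarrow> g (x - a) \<le> 1"
    "objective a g < \<infinity>"
proof -
  show *: "g \<in> finvol_polys d" using assms by (simp add: feasible_def)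
  then show "g \<in> hom_polys d" "objective a g < \<infinity>" by (auto simp: finvol_polys_def objective_eq)
  show "\<And>x. g x \<ge> 0" by (rule finvol_polys_nonneg[OF *])
  fix x assume "x \<in> K"
  then show "g (x - a) \<le> 1" using assms by (simp add: feasible_def nonneg_polys_def)
qed

lemma feasibleI:
  assumes "g \<in> finvol_polys d" "\<And>x. x \<in> K \<Longrightarrow> g (x - a) \<le> 1"
  shows "feasible K d a g"
  using assms hom_polys_translate_le[of g d a]
  by (auto simp: feasible_def finvol_polys_def nonneg_polys_def)

text \<open>
  A small multiple of \<open>\<Sum> x\<^sub>i\<^sup>d\<close> is at most \<open>1\<close> on \<open>K\<close>, and its sublevel set is bounded since \<open>d\<close> is
  even and positive.
\<close>

lemma feasible_exists:
  fixes K :: "(real ^ 'n::finite) set"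
  assumes d: "even d" "d > 0" and K: "compact K"
  shows "\<exists>g. feasible K d 0 g"
proof -
  obtain B where B: "B > 0" "\<And>x. x \<in> K \<Longrightarrow> norm x \<le> B"
    using compact_imp_bounded[OF K] by (auto simp: bounded_pos)
  \<comment> \<open>Chosen so that \<open>g \<le> 1\<close> on the cube of half side \<open>B\<close>, which contains \<open>K\<close>.\<close>
  define C where "C = 1 / (real CARD('n) * B ^ d)"
  have C: "C > 0" using B by (simp add: C_def)
  define g where "g x = (\<Sum>i\<in>UNIV. C * (x $ i) ^ d)" for x :: "real ^ 'n"
  have mono: "(x $ i) ^ d = mpow x (\<lambda>j. if j = i then d else 0)" for x :: "real ^ 'n" and i
    by (simp add: mpow_def if_distrib[of "\<lambda>u. _ ^ u"] cong: if_cong)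
  have hom: "g \<in> hom_polys d"
    unfolding hom_polys_span g_def[abs_def] mono
    by (intro monomial_span_sum monomial_span_scale monomial_span_monomial finite_mdeg_eq)
      (simp add: mdeg_def)
  have coord: "\<bar>x $ i\<bar> \<le> max 1 (1 / C)" if "g x \<le> 1" for x i
  proof (cases "\<bar>x $ i\<bar> \<le> 1")
    case False
    have "C * (x $ i) ^ d \<le> g x"
      unfolding g_def using C d by (intro member_le_sum) (auto intro: mult_nonneg_nonneg zero_le_even_power)
    then have "(x $ i) ^ d \<le> 1 / C" using that C by (simp add: field_simps)
    moreover have "\<bar>x $ i\<bar> ^ 1 \<le> \<bar>x $ i\<bar> ^ d" using False d by (intro power_increasing) auto
    moreover have "\<bar>x $ i\<bar> ^ d = (x $ i) ^ d" using d by (simp add: power_even_abs)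
    ultimately show ?thesis by simp
  qed auto
  have "bounded {x. g x \<le> 1}"
  proof (rule boundedI)
    fix x assume "x \<in> {x. g x \<le> 1}"
    then have "norm x \<le> (\<Sum>i\<in>(UNIV :: 'n set). max 1 (1 / C))"
      using coord by (intro order_trans[OF norm_le_l1_cart] sum_mono) auto
    then show "norm x \<le> real CARD('n) * max 1 (1 / C)" by simp
  qed
  then have "emeasure lebesgue {x. g x \<le> 1} < \<infinity>"
    using emeasure_bounded_finite sets_borel_sublevel[OF hom] by simp
  then have "g \<in> finvol_polys d" using hom by (simp add: finvol_polys_def)
  moreover have "g x \<le> 1" if "x \<in> K" for x
  proof -
    have "(x $ i) ^ d \<le> B ^ d" for i
    proof -
      have "\<bar>x $ i\<bar> \<le> B" using component_le_norm_cart[of x i] B(2)[OF that] by linarith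
      then have "\<bar>x $ i\<bar> ^ d \<le> B ^ d" by (intro power_mono) auto
      then show ?thesis using d by (simp add: power_even_abs)
    qed
    then have "g x \<le> (\<Sum>i\<in>(UNIV :: 'n set). C * B ^ d)"
      unfolding g_def using C by (intro sum_mono mult_left_mono) auto
    also have "\<dots> = 1" using B by (simp add: C_def)
    finally show ?thesis .
  qed
  ultimately show ?thesis by (intro exI[of _ g] feasibleI) auto
qed

text \<open>
  The sublevel set contains the ball about \<open>w\<close> and, being star-shaped, also its contractions
  towards the origin. Along the segment from \<open>w\<close> to \<open>w / 2\<close> these contain balls of radius \<open>r / 2\<close>
  with centres at distance \<open>r\<close>; if \<open>w\<close> is far away, \<open>m\<close> of them fit disjointly and exceed the
  volume bound \<open>M\<close>.
\<close>

lemma norm_center_le: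
  fixes g :: "real ^ 'n::finite \<Rightarrow> real"
  assumes g: "g \<in> finvol_polys d" and r: "r > 0"
    and ball: "\<And>x. x \<in> ball w r \<Longrightarrow> g x \<le> 1"
    and vol: "emeasure lebesgue {x. g x \<le> 1} \<le> ennreal M"
    and M: "0 \<le> M" "M < real m * (unit_ball_vol (real CARD('n)) * (r / 2) ^ CARD('n))"
  shows "norm w \<le> 2 * real m * r"
proof (rule ccontr)
  assume "\<not> norm w \<le> 2 * real m * r"
  then have far: "2 * real m * r < norm w" by simp
  moreover have "0 \<le> 2 * real m * r" using r by simp
  ultimately have w: "norm w > 0" by linarith
  have hom: "g \<in> hom_polys d" using g by (simp add: finvol_polys_def)
  define \<tau> where "\<tau> j = 1 - real j * r / norm w" for j
  define Bl where "Bl j = ball (\<tau> j *\<^sub>R w) (r / 2)" for j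
  have \<tau>: "1 / 2 \<le> \<tau> j" "\<tau> j \<le> 1" if "j < m" for j
  proof -
    have "real j * r \<le> real m * r" using that r by simp
    then have "real j * r / norm w \<le> 1 / 2" using far w by (simp add: field_simps)
    then show "1 / 2 \<le> \<tau> j" by (simp add: \<tau>_def)
    show "\<tau> j \<le> 1" using r by (simp add: \<tau>_def)
  qed
  have sub: "Bl j \<subseteq> {x. g x \<le> 1}" if "j < m" for j
  proof
    fix y assume "y \<in> Bl j"
    then have y: "norm (\<tau> j *\<^sub>R w - y) < r / 2" by (simp add: Bl_def dist_norm)
    note \<tau>j = \<tau>[OF that]
    define z where "z = (1 / \<tau> j) *\<^sub>R y"
    have yz: "y = \<tau> j *\<^sub>R z" using \<tau>j by (simp add: z_def)
    have "\<tau> j * norm (w - z) < r / 2"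
      using y \<tau>j by (simp add: yz flip: scaleR_diff_right)
    moreover have "1 / 2 * norm (w - z) \<le> \<tau> j * norm (w - z)" using \<tau>j by (intro mult_right_mono) auto
    ultimately have "z \<in> ball w r" by (simp add: dist_norm)
    then have "g z \<le> 1" by (rule ball)
    moreover have "\<tau> j ^ d \<le> 1" using \<tau>j by (intro power_le_one) auto
    ultimately have "\<tau> j ^ d * g z \<le> 1"
      using finvol_polys_nonneg[OF g, of z] by (intro mult_le_one) auto
    then show "y \<in> {x. g x \<le> 1}" by (simp add: yz hom_polys_scaleR[OF hom])
  qed
  have "disjoint_family_on Bl {..<m}"
  proof (unfold disjoint_family_on_def, intro ballI impI)
    fix i j :: nat assume "i \<noteq> j"
    have "(\<tau> i - \<tau> j) * norm w = (real j - real i) * r"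
      using w by (simp add: \<tau>_def field_simps)
    then have "dist (\<tau> i *\<^sub>R w) (\<tau> j *\<^sub>R w) = \<bar>real j - real i\<bar> * r"
      using r w by (simp add: dist_norm abs_mult flip: scaleR_diff_left)
        (metis abs_mult abs_norm_cancel abs_of_pos)
    moreover have "1 \<le> \<bar>real j - real i\<bar>" using \<open>i \<noteq> j\<close> by linarith
    ultimately have "r \<le> dist (\<tau> i *\<^sub>R w) (\<tau> j *\<^sub>R w)" using r by simp
    then show "Bl i \<inter> Bl j = {}" unfolding Bl_def by (intro disjoint_ballI) simp
  qed
  moreover have "Bl j \<in> sets lborel" for j by (simp add: Bl_def)
  ultimately have "(\<Sum>j<m. emeasure lborel (Bl j)) = emeasure lborel (\<Union>j<m. Bl j)"
    by (intro sum_emeasure) auto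
  also have "\<dots> \<le> emeasure lborel {x. g x \<le> 1}"
    using sub sets_borel_sublevel[OF hom] by (intro emeasure_mono) auto
  also have "\<dots> \<le> ennreal M" using vol sets_borel_sublevel[OF hom] by simp
  also have "(\<Sum>j<m. emeasure lborel (Bl j)) = ennreal (real m * (unit_ball_vol (real CARD('n)) * (r / 2) ^ CARD('n)))"
    using r by (simp add: Bl_def emeasure_ball ennreal_mult' ennreal_of_nat_eq_real_of_nat)
  finally show False using M by (simp add: ennreal_le_iff)
qed

text \<open>
  A subsequence of a minimising sequence converges, first in the centres and then in the
  polynomials, and the limit is feasible with optimal volume.
\<close>

lemma optimal_exists:
  fixes K :: "(real ^ 'n::finite) set"
  assumes d: "even d" "d > 0" and K: "compact K" "interior K \<noteq> {}"
  shows "\<exists>a g. optimal K d a g"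
proof -
  obtain z where "z \<in> interior K" using K by blast
  then obtain r where r: "r > 0" "ball z r \<subseteq> K" by (auto simp: mem_interior)
  define Ob where "Ob = {objective a g | a g. feasible K d a g}"
  define \<rho> where "\<rho> = Inf Ob"
  obtain g0 where g0: "feasible K d 0 g0" using feasible_exists[OF d K(1)] by blast
  then have Ob: "objective 0 g0 \<in> Ob" by (auto simp: Ob_def)
  then have \<rho>: "\<rho> < \<infinity>"
    unfolding \<rho>_def using feasibleD(5)[OF g0] by (auto intro: le_less_trans[OF Inf_lower])
  obtain p where p: "\<rho> = ennreal p" "p \<ge> 0" using \<rho> by (cases \<rho>) auto
  obtain u where u: "\<And>k. u k \<in> Ob" "u \<longlonglongrightarrow> \<rho>"
    using Inf_as_limit[of Ob] Ob by (auto simp: \<rho>_def)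
  have "\<rho> < ennreal (p + 1)" using p by (simp add: ennreal_lessI)
  then obtain N0 where N0: "\<And>k. k \<ge> N0 \<Longrightarrow> u k < ennreal (p + 1)"
    using order_tendstoD(2)[OF u(2)] by (auto simp: eventually_sequentially)
  have "\<forall>k. \<exists>a g. feasible K d a g \<and> u (k + N0) = objective a g"
  proof
    fix k
    from u(1)[of "k + N0"] show "\<exists>a g. feasible K d a g \<and> u (k + N0) = objective a g"
      by (auto simp: Ob_def)
  qed
  then obtain A G where feas: "\<And>k. feasible K d (A k) (G k)" and obj: "\<And>k. u (k + N0) = objective (A k) (G k)"
    by metis
  have Gball: "G k x \<le> 1" if "x \<in> ball (z - A k) r" for k x
  proof -
    have "x + A k \<in> ball z r" using that by (simp add: dist_norm algebra_simps)
    then have "x + A k \<in> K" using r by blast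
    then show ?thesis using feasibleD(4)[OF feas, of "x + A k" k] by simp
  qed
  define v where "v = unit_ball_vol (real CARD('n)) * (r / 2) ^ CARD('n)"
  have v: "v > 0" using r by (simp add: v_def)
  obtain m :: nat where "(p + 1) / v < real m" using reals_Archimedean2 by blast
  then have m: "p + 1 < real m * v" using v by (simp add: field_simps)
  \<comment> \<open>Volumes at most \<open>p + 1\<close> keep the centres within a fixed distance of \<open>z\<close>.\<close>
  have bdd: "norm (z - A k) \<le> 2 * real m * r" for k
  proof (rule norm_center_le[OF feasibleD(1)[OF feas] r(1) Gball])
    show "emeasure lebesgue {x. G k x \<le> 1} \<le> ennreal (p + 1)"
      using N0[of "k + N0"] by (simp add: obj objective_eq less_imp_le)
  qed (use m p in \<open>auto simp: v_def\<close>)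
  have "seq_compact (cball 0 (2 * real m * r) :: (real ^ 'n) set)"
    by (simp add: compact_imp_seq_compact)
  moreover have "\<forall>k. z - A k \<in> cball 0 (2 * real m * r)" using bdd by simp
  ultimately obtain w s1 where s1: "strict_mono (s1 :: nat \<Rightarrow> nat)" and "((\<lambda>k. z - A k) \<circ> s1) \<longlonglongrightarrow> w"
    by (rule seq_compactE)
  then have w: "(\<lambda>k. z - A (s1 k)) \<longlonglongrightarrow> w" by (simp add: o_def)
  then obtain N1 where N1: "\<And>k. k \<ge> N1 \<Longrightarrow> dist (z - A (s1 k)) w < r / 2"
    using r by (meson half_gt_zero lim_sequentially)
  obtain X L where X: "finite X" "X \<subseteq> ball w (r / 2)"
    and L: "\<And>x. x \<in> X \<Longrightarrow> L x \<in> hom_polys d"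
    and rep: "\<And>g y. g \<in> hom_polys d \<Longrightarrow> g y = (\<Sum>x\<in>X. g x * L x y)"
    using hom_polys_interpolation[of "r / 2" w d] half_gt_zero[OF r(1)] by blast
  \<comment> \<open>The nodes are within \<open>r / 2\<close> of \<open>w\<close>, hence within \<open>r\<close> of the late ball centres.\<close>
  have GX: "\<bar>G (s1 (k + N1)) x\<bar> \<le> 1" if "x \<in> X" for k x
  proof -
    have "dist (z - A (s1 (k + N1))) x \<le> dist (z - A (s1 (k + N1))) w + dist w x" by (rule dist_triangle)
    also have "\<dots> < r" using N1[of "k + N1"] that X by force
    finally have "G (s1 (k + N1)) x \<le> 1" by (intro Gball) simp
    then show ?thesis using feasibleD(3)[OF feas] by simp
  qed
  obtain l s2 where s2: "strict_mono (s2 :: nat \<Rightarrow> nat)"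
    and l: "\<And>x. x \<in> X \<Longrightarrow> (\<lambda>k. G (s1 (s2 k + N1)) x) \<longlonglongrightarrow> l x"
    using convergent_subsequence_on_finite_set[OF X(1), of "\<lambda>k. G (s1 (k + N1))" 1, OF GX] by blast
  define s where "s k = s1 (s2 k + N1)" for k
  have s: "strict_mono s" using s1 s2 by (simp add: s_def strict_mono_def)
  define g where "g y = (\<Sum>x\<in>X. l x * L x y)" for y
  define a where "a = z - w"
  have hom: "g \<in> hom_polys d"
    unfolding g_def[abs_def] hom_polys_span using L
    by (intro monomial_span_sum monomial_span_scale) (simp add: hom_polys_span)
  have lim: "(\<lambda>k. G (s k) (y k)) \<longlonglongrightarrow> g y0" if y: "y \<longlonglongrightarrow> y0" for y y0
  proof -
    have "(\<lambda>k. L x (y k)) \<longlonglongrightarrow> L x y0" if "x \<in> X" for x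
      using continuous_on_hom_polys[OF L[OF that], of UNIV] y
      by (auto simp: continuous_on_eq_continuous_at isCont_tendsto_compose)
    then have "(\<lambda>k. \<Sum>x\<in>X. G (s k) x * L x (y k)) \<longlonglongrightarrow> g y0"
      unfolding g_def s_def by (intro tendsto_sum tendsto_mult l) auto
    then show ?thesis by (simp only: rep[OF feasibleD(2)[OF feas], symmetric])
  qed
  have g0: "g y \<ge> 0" for y
    by (rule LIMSEQ_le_const[OF lim[OF tendsto_const]]) (use feasibleD(3)[OF feas] in auto)
  have limA: "(\<lambda>k. A (s k)) \<longlonglongrightarrow> a"
  proof -
    have "(\<lambda>k. z - A (s1 (s2 k + N1))) \<longlonglongrightarrow> w"
      using LIMSEQ_subseq_LIMSEQ[OF w, of "\<lambda>k. s2 k + N1"] s2 by (simp add: o_def strict_mono_def)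
    then have "(\<lambda>k. z - (z - A (s k))) \<longlonglongrightarrow> z - w" unfolding s_def by (intro tendsto_diff tendsto_const)
    then show ?thesis by (simp add: a_def)
  qed
  have gK: "g (x - a) \<le> 1" if "x \<in> K" for x
  proof (rule LIMSEQ_le_const2)
    show "(\<lambda>k. G (s k) (x - A (s k))) \<longlonglongrightarrow> g (x - a)"
      by (intro lim tendsto_diff tendsto_const limA)
  qed (use feasibleD(4)[OF feas that] in auto)
  have limu: "(\<lambda>k. emeasure lborel {y. G (s k) y \<le> 1}) \<longlonglongrightarrow> \<rho>"
  proof -
    have "(\<lambda>k. u (s k + N0)) \<longlonglongrightarrow> \<rho>"
      using LIMSEQ_subseq_LIMSEQ[OF u(2), of "\<lambda>k. s k + N0"] s by (simp add: o_def strict_mono_def)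
    then show ?thesis
      using sets_borel_sublevel[OF feasibleD(2)[OF feas]] by (simp add: obj objective_eq)
  qed
  \<comment> \<open>Fatou: points with strict inequality for \<open>g\<close> are eventually in the approximating sublevel sets.\<close>
  have "emeasure lborel {y. g y < 1} \<le> \<rho>"
  proof -
    have "emeasure lborel {y. g y < 1} = (\<integral>\<^sup>+y. indicator {y. g y < 1} y \<partial>lborel)"
      using sets_borel_sublevel[OF hom] by simp
    also have "\<dots> \<le> (\<integral>\<^sup>+y. liminf (\<lambda>k. indicator {y. G (s k) y \<le> 1} y) \<partial>lborel)"
    proof (rule nn_integral_mono)
      fix y
      show "indicator {y. g y < 1} y \<le> liminf (\<lambda>k. indicator {y. G (s k) y \<le> 1} y :: ennreal)"
      proof (cases "g y < 1")
        case True
        have "eventually (\<lambda>k. G (s k) y < 1) sequentially"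
          using lim[OF tendsto_const] True by (rule order_tendstoD)
        then have "(1 :: ennreal) \<le> liminf (\<lambda>k. indicator {y. G (s k) y \<le> 1} y)"
          by (intro Liminf_bounded) (auto elim: eventually_mono)
        then show ?thesis using True by simp
      qed simp
    qed
    also have "\<dots> \<le> liminf (\<lambda>k. \<integral>\<^sup>+y. indicator {y. G (s k) y \<le> 1} y \<partial>lborel)"
      using sets_borel_sublevel[OF feasibleD(2)[OF feas]] by (intro nn_integral_liminf) auto
    also have "\<dots> = liminf (\<lambda>k. emeasure lborel {y. G (s k) y \<le> 1})"
      using sets_borel_sublevel[OF feasibleD(2)[OF feas]] by simp
    also have "\<dots> = \<rho>" using limu by (intro lim_imp_Liminf) auto
    finally show ?thesis .
  qed
  then have open_vol: "emeasure lebesgue {y. g y < 1} \<le> \<rho>" using sets_borel_sublevel[OF hom] by simp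
  \<comment> \<open>Boundary points of \<open>{g \<le> 1}\<close> get a strict inequality by shrinking; let \<open>t\<close> tend to \<open>1\<close>.\<close>
  have scaled: "ennreal (t ^ CARD('n)) * emeasure lebesgue {y. g y \<le> 1} \<le> \<rho>" if t: "0 < t" "t < 1" for t
  proof -
    have "(*\<^sub>R) t ` {y. g y \<le> 1} \<subseteq> {y. g y < 1}"
    proof clarsimp
      fix y assume "g y \<le> 1"
      then have "t ^ d * g y \<le> t ^ d" using t by (simp add: mult_left_le)
      also have "\<dots> < 1" using t d by (simp add: power_Suc_less_one power_less_one_iff)
      finally show "g (t *\<^sub>R y) < 1" by (simp add: hom_polys_scaleR[OF hom])
    qed
    then have "emeasure lebesgue ((*\<^sub>R) t ` {y. g y \<le> 1}) \<le> emeasure lebesgue {y. g y < 1}"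
      using sets_borel_sublevel[OF hom] by (intro emeasure_mono) auto
    then show ?thesis using emeasure_lebesgue_scaled[of t "{y. g y \<le> 1}"] t open_vol by simp
  qed
  have fin: "emeasure lebesgue {y. g y \<le> 1} < \<infinity>"
  proof (rule ccontr)
    assume "\<not> emeasure lebesgue {y. g y \<le> 1} < \<infinity>"
    then have "emeasure lebesgue {y. g y \<le> 1} = \<infinity>"
      by (metis infinity_ennreal_def less_top)
    moreover have "ennreal ((1 / 2) ^ CARD('n)) * \<infinity> = \<infinity>" by (simp add: ennreal_mult_top)
    ultimately show False using scaled[of "1/2"] p by (simp add: top_unique)
  qed
  then obtain V where V: "emeasure lebesgue {y. g y \<le> 1} = ennreal V" "V \<ge> 0"
    by (cases "emeasure lebesgue {y. g y \<le> 1}") auto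
  have "V \<le> p"
  proof (rule tendsto_upperbound)
    have "((\<lambda>t. t ^ CARD('n) * V) \<longlongrightarrow> 1 ^ CARD('n) * V) (at_left 1)" by (intro tendsto_intros)
    then show "((\<lambda>t. t ^ CARD('n) * V) \<longlongrightarrow> V) (at_left 1)" by simp
    have "eventually (\<lambda>t. t \<in> {0<..<1::real}) (at_left 1)" by (rule eventually_at_left_real) simp
    then show "eventually (\<lambda>t. t ^ CARD('n) * V \<le> p) (at_left (1::real))"
    proof eventually_elim
      case (elim t)
      then show ?case using scaled[of t] V p by (simp flip: ennreal_mult')
    qed
  qed simp
  then have "objective a g \<le> \<rho>" by (simp add: objective_eq V p ennreal_leI)
  moreover have "\<rho> \<le> objective b h" if "feasible K d b h" for b h
    unfolding \<rho>_def using that by (intro Inf_lower) (auto simp: Ob_def)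
  moreover have "feasible K d a g"
    using hom fin gK by (intro feasibleI) (auto simp: finvol_polys_def)
  ultimately have "optimal K d a g" unfolding optimal_def using order_trans by blast
  then show ?thesis by blast
qed

section \<open>First-order optimality\<close>

text \<open>
  Half of the exponent \<open>t0 |h|\<close> pays for the factor \<open>|h|\<close>, the other half for the tilt by \<open>t\<close>.
\<close>

lemma exp_tilt_bound:
  fixes h t t0 :: real
  assumes t0: "t0 > 0" and t: "\<bar>t\<bar> \<le> t0 / 2"
  shows "\<bar>h\<bar> * exp (- (t * h)) \<le> 2 / t0 * (exp (- (t0 * h)) + exp (t0 * h))"
proof -
  have "t0 / 2 * \<bar>h\<bar> \<le> exp (t0 / 2 * \<bar>h\<bar>)"
    using exp_ge_add_one_self[of "t0 / 2 * \<bar>h\<bar>"] by linarith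
  then have h: "\<bar>h\<bar> \<le> 2 / t0 * exp (t0 / 2 * \<bar>h\<bar>)" using t0 by (simp add: field_simps)
  have "- (t * h) \<le> \<bar>t\<bar> * \<bar>h\<bar>" by (metis abs_ge_minus_self abs_mult)
  also have "\<dots> \<le> t0 / 2 * \<bar>h\<bar>" using t by (intro mult_right_mono) auto
  finally have "\<bar>h\<bar> * exp (- (t * h)) \<le> (2 / t0 * exp (t0 / 2 * \<bar>h\<bar>)) * exp (t0 / 2 * \<bar>h\<bar>)"
    using h t0 by (intro mult_mono) auto
  also have "\<dots> = 2 / t0 * exp (t0 * \<bar>h\<bar>)" by (simp add: mult.assoc flip: exp_add)
  also have "\<dots> \<le> 2 / t0 * (exp (- (t0 * h)) + exp (t0 * h))"
    using t0 by (intro mult_left_mono) (auto simp: abs_if)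
  finally show ?thesis .
qed

text \<open>
  The two integrable functions \<open>exp (- (g \<plusminus> t0 h))\<close> dominate, up to a constant, the whole family
  \<open>h exp (- (g + t h))\<close> for small \<open>t\<close>; this serves for integrability of moments and for the limit
  \<open>t \<rightarrow> 0\<close>.
\<close>

lemma int_finvol_polys_dominated:
  fixes g h :: "real ^ 'n::finite \<Rightarrow> real"
  assumes g: "g \<in> int_finvol_polys d" and h: "h \<in> hom_polys d" and d: "d > 0"
  shows "\<exists>t0>0. \<exists>D. (\<forall>t. \<bar>t\<bar> \<le> t0 \<longrightarrow> (\<lambda>x. g x + t * h x) \<in> finvol_polys d) \<and> integrable lborel D
    \<and> (\<forall>t x. \<bar>t\<bar> \<le> t0 \<longrightarrow> \<bar>h x * exp (- (g x + t * h x))\<bar> \<le> D x)"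
proof -
  obtain t0 where t0: "t0 > 0" "\<And>t. \<bar>t\<bar> \<le> t0 \<Longrightarrow> (\<lambda>x. g x + t * h x) \<in> finvol_polys d"
    using int_finvol_polys_direction[OF g h] by blast
  define D where "D x = 2 / t0 * (exp (- (g x + t0 * h x)) + exp (- (g x + (- t0) * h x)))" for x
  have "integrable lborel D"
    unfolding D_def[abs_def] using t0 by (intro integrable_mult_right Bochner_Integration.integrable_add
      finvol_polys_exp(1)[OF _ d] t0(2)) auto
  moreover have "\<bar>h x * exp (- (g x + t * h x))\<bar> \<le> D x" if "\<bar>t\<bar> \<le> t0 / 2" for t x
  proof -
    have "\<bar>h x * exp (- (g x + t * h x))\<bar> = exp (- g x) * (\<bar>h x\<bar> * exp (- (t * h x)))"
      by (simp add: abs_mult exp_diff exp_minus field_simps)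
    also have "\<dots> \<le> exp (- g x) * (2 / t0 * (exp (- (t0 * h x)) + exp (t0 * h x)))"
      using exp_tilt_bound[OF t0(1) that] by (intro mult_left_mono) auto
    also have "\<dots> = D x"
    proof -
      have "exp (- (g x + t0 * h x)) = exp (- g x) * exp (- (t0 * h x))"
        "exp (- (g x + (- t0) * h x)) = exp (- g x) * exp (t0 * h x)"
        by (simp_all flip: exp_add)
      then show ?thesis unfolding D_def by (simp only: distrib_left mult.left_commute)
    qed
    finally show ?thesis .
  qed
  ultimately show ?thesis using t0 by (intro exI[of _ "t0 / 2"] conjI exI[of _ D]) auto
qed

lemma integrable_hom_polys_exp:
  fixes g h :: "real ^ 'n::finite \<Rightarrow> real"
  assumes g: "g \<in> int_finvol_polys d" and h: "h \<in> hom_polys d" and d: "d > 0"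
  shows "integrable lborel (\<lambda>x. h x * exp (- g x))"
proof -
  obtain t0 D where t0: "t0 > 0" and D: "integrable lborel D"
    and bound: "\<forall>t x. \<bar>t\<bar> \<le> t0 \<longrightarrow> \<bar>h x * exp (- (g x + t * h x))\<bar> \<le> D x"
    using int_finvol_polys_dominated[OF assms] by blast
  have [measurable]: "g \<in> borel_measurable borel" "h \<in> borel_measurable borel"
    using int_finvol_polys_imp[OF g] h by (auto intro: borel_measurable_hom_polys simp: finvol_polys_def)
  show ?thesis
  proof (rule Bochner_Integration.integrable_bound[OF D])
    have "\<bar>h x * exp (- g x)\<bar> \<le> \<bar>D x\<bar>" for x
      using bound[rule_format, of 0 x] t0 by simp
    then show "AE x in lborel. norm (h x * exp (- g x)) \<le> norm (D x)" by simp
  qed measurable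
qed

lemma compact_translate: "compact K \<Longrightarrow> compact (translate K a)"
  using compact_translation_subtract[of K a] by (simp add: translate_def Setcompr_eq_image)

text \<open>
  Where \<open>h < 0\<close> the perturbation only helps; the compact remainder stays away from the level
  \<open>g = 1\<close>.
\<close>

lemma stays_below_one:
  fixes g h :: "'a::metric_space \<Rightarrow> real"
  assumes S: "compact S" and cont: "continuous_on S g" "continuous_on S h"
    and le: "\<And>x. x \<in> S \<Longrightarrow> g x \<le> 1" and neg: "\<And>x. x \<in> S \<Longrightarrow> g x = 1 \<Longrightarrow> h x < 0"
  shows "\<exists>t1>0. \<forall>t x. 0 \<le> t \<and> t \<le> t1 \<and> x \<in> S \<longrightarrow> g x + t * h x \<le> 1"
proof -
  define B where "B = {x\<in>S. 0 \<le> h x}"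
  have nB: "g x + t * h x \<le> 1" if "x \<in> S" "x \<notin> B" "0 \<le> t" for x t
  proof -
    have "t * h x \<le> 0" using that by (intro mult_nonneg_nonpos) (auto simp: B_def)
    then show ?thesis using le[OF that(1)] by linarith
  qed
  show ?thesis
  proof (cases "B = {}")
    case True
    then show ?thesis using nB by (intro exI[of _ 1]) auto
  next
    case False
    have "closedin (top_of_set S) B"
    proof -
      have "B = S \<inter> h -` {0..}" by (auto simp: B_def)
      then show ?thesis using continuous_closedin_preimage[OF cont(2), of "{0..}"] by simp
    qed
    then have "compact B" using S closedin_compact by blast
    moreover have BS: "B \<subseteq> S" by (auto simp: B_def)
    ultimately obtain x0 where x0: "x0 \<in> B" "\<And>x. x \<in> B \<Longrightarrow> g x \<le> g x0"
      using continuous_attains_sup[of B g] continuous_on_subset[OF cont(1)] False by blast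
    obtain x1 where x1: "x1 \<in> B" "\<And>x. x \<in> B \<Longrightarrow> h x \<le> h x1"
      using continuous_attains_sup[of B h] continuous_on_subset[OF cont(2) BS] \<open>compact B\<close> False by blast
    have m: "g x0 < 1" using le[of x0] neg[of x0] x0(1) by (force simp: B_def)
    have h1: "h x1 \<ge> 0" using x1 by (simp add: B_def)
    define t1 where "t1 = (1 - g x0) / (h x1 + 1)"
    have t1: "t1 > 0" using m h1 by (simp add: t1_def)
    have "g x + t * h x \<le> 1" if "0 \<le> t" "t \<le> t1" "x \<in> S" for t x
    proof (cases "x \<in> B")
      case True
      then have "t * h x \<le> t1 * h x1" using that x1 t1 by (intro mult_mono) (auto simp: B_def)
      also have "\<dots> \<le> t1 * (h x1 + 1)" using t1 by (simp add: algebra_simps)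
      also have "\<dots> = 1 - g x0" using h1 by (simp add: t1_def)
      finally show ?thesis using x0(2)[OF True] by linarith
    qed (use nB that in blast)
    then show ?thesis using t1 by blast
  qed
qed

text \<open>
  Moving to \<open>g + t h\<close> keeps feasibility for small \<open>t > 0\<close>, so the integral of \<open>exp (- g)\<close> cannot
  decrease. The convexity estimate \<open>exp (- g) \<ge> (1 + t h) exp (- (g + t h))\<close> then forces
  \<open>\<integral> h exp (- (g + t h)) \<le> 0\<close>, and \<open>t \<rightarrow> 0\<close> gives the claim.
\<close>

lemma optimal_no_descent_direction:
  fixes K :: "(real ^ 'n::finite) set"
  assumes opt: "optimal K d a g" and int: "g \<in> int_finvol_polys d" and h: "h \<in> hom_polys d"
    and d: "d > 0" and K: "compact K"
    and neg: "\<And>x. x \<in> translate K a \<Longrightarrow> g x = 1 \<Longrightarrow> h x < 0"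
  shows "(\<integral>x. h x * exp (- g x) \<partial>lborel) \<le> 0"
proof -
  have feas: "feasible K d a g" and best: "\<And>b f. feasible K d b f \<Longrightarrow> objective a g \<le> objective b f"
    using opt by (auto simp: optimal_def)
  note g = feasibleD(1,2)[OF feas]
  have [measurable]: "g \<in> borel_measurable borel" "h \<in> borel_measurable borel"
    using g h by (auto intro: borel_measurable_hom_polys)
  obtain t0 D where t0: "t0 > 0" and fin: "\<forall>t. \<bar>t\<bar> \<le> t0 \<longrightarrow> (\<lambda>x. g x + t * h x) \<in> finvol_polys d"
    and D: "integrable lborel D" and bound: "\<forall>t x. \<bar>t\<bar> \<le> t0 \<longrightarrow> \<bar>h x * exp (- (g x + t * h x))\<bar> \<le> D x"
    using int_finvol_polys_dominated[OF int h d] by blast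
  obtain t1 where t1: "t1 > 0"
    and below: "\<forall>t x. 0 \<le> t \<and> t \<le> t1 \<and> x \<in> translate K a \<longrightarrow> g x + t * h x \<le> 1"
  proof -
    have "g x \<le> 1" if "x \<in> translate K a" for x
      using that feasibleD(4)[OF feas] by (auto simp: translate_def)
    then show ?thesis
      using stays_below_one[OF compact_translate[OF K, of a], of g h] neg continuous_on_hom_polys g(2) h that by blast
  qed
  define T where "T = min t0 t1"
  have T: "T > 0" using t0 t1 by (simp add: T_def)
  have key: "(\<integral>x. h x * exp (- (g x + t * h x)) \<partial>lborel) \<le> 0" if t: "0 < t" "t \<le> T" for t
  proof -
    have gt: "(\<lambda>x. g x + t * h x) \<in> finvol_polys d" using fin t by (simp add: T_def)
    have "g (x - a) + t * h (x - a) \<le> 1" if "x \<in> K" for x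
    proof -
      have "x - a \<in> translate K a" using that by (auto simp: translate_def)
      then show ?thesis using below t by (simp add: T_def)
    qed
    then have "feasible K d a (\<lambda>x. g x + t * h x)" using gt by (intro feasibleI) auto
    from best[OF this] have "emeasure lebesgue {x. g x \<le> 1} \<le> emeasure lebesgue {x. g x + t * h x \<le> 1}"
      by (simp add: objective_eq)
    then have "ennreal (\<integral>x. exp (- g x) \<partial>lborel) \<le> ennreal (\<integral>x. exp (- (g x + t * h x)) \<partial>lborel)"
      unfolding finvol_polys_exp(2)[OF g(1) d] finvol_polys_exp(2)[OF gt d] by (rule mult_left_mono) simp
    then have less: "(\<integral>x. exp (- g x) \<partial>lborel) \<le> (\<integral>x. exp (- (g x + t * h x)) \<partial>lborel)"
      by (subst (asm) ennreal_le_iff) (auto intro!: integral_nonneg_AE)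
    have inth: "integrable lborel (\<lambda>x. h x * exp (- (g x + t * h x)))"
    proof (rule Bochner_Integration.integrable_bound[OF D])
      have "\<bar>h x * exp (- (g x + t * h x))\<bar> \<le> \<bar>D x\<bar>" for x
        using bound[rule_format, of t x] t by (simp add: T_def)
      then show "AE x in lborel. norm (h x * exp (- (g x + t * h x))) \<le> norm (D x)" by simp
    qed measurable
    have "(\<integral>x. exp (- (g x + t * h x)) + t * (h x * exp (- (g x + t * h x))) \<partial>lborel) \<le> (\<integral>x. exp (- g x) \<partial>lborel)"
    proof (rule integral_mono)
      fix x
      have "(1 + t * h x) * exp (- (g x + t * h x)) \<le> exp (t * h x) * exp (- (g x + t * h x))"
        by (intro mult_right_mono exp_ge_add_one_self) auto
      also have "\<dots> = exp (- g x)" by (simp flip: exp_add)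
      finally show "exp (- (g x + t * h x)) + t * (h x * exp (- (g x + t * h x))) \<le> exp (- g x)"
        by (simp add: algebra_simps)
    qed (use finvol_polys_exp(1)[OF g(1) d] finvol_polys_exp(1)[OF gt d] inth in auto)
    then have "(\<integral>x. exp (- (g x + t * h x)) \<partial>lborel) + t * (\<integral>x. h x * exp (- (g x + t * h x)) \<partial>lborel)
        \<le> (\<integral>x. exp (- g x) \<partial>lborel)"
      using finvol_polys_exp(1)[OF gt d] inth by simp
    then have "t * (\<integral>x. h x * exp (- (g x + t * h x)) \<partial>lborel) \<le> 0" using less by linarith
    then show ?thesis using t by (simp add: mult_le_0_iff)
  qed
  define t where "t k = T / real (Suc k)" for k
  have t: "0 < t k" "t k \<le> T" for k
    using T by (auto simp: t_def field_simps)
  have tlim: "t \<longlonglongrightarrow> 0"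
    unfolding t_def[abs_def] by (rule real_tendsto_divide_at_top[OF tendsto_const])
      (intro filterlim_compose[OF filterlim_real_sequentially] filterlim_Suc)
  have "(\<lambda>k. \<integral>x. h x * exp (- (g x + t k * h x)) \<partial>lborel) \<longlonglongrightarrow> (\<integral>x. h x * exp (- g x) \<partial>lborel)"
  proof (rule integral_dominated_convergence[where w = D])
    show "AE x in lborel. (\<lambda>k. h x * exp (- (g x + t k * h x))) \<longlonglongrightarrow> h x * exp (- g x)"
    proof (rule AE_I2)
      fix x
      have "(\<lambda>k. h x * exp (- (g x + t k * h x))) \<longlonglongrightarrow> h x * exp (- (g x + 0 * h x))"
        by (intro tendsto_intros tlim)
      then show "(\<lambda>k. h x * exp (- (g x + t k * h x))) \<longlonglongrightarrow> h x * exp (- g x)" by simp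
    qed
    show "AE x in lborel. norm (h x * exp (- (g x + t k * h x))) \<le> D x" for k
      using bound t[of k] by (intro AE_I2) (simp add: T_def)
  qed (use D in auto)
  then show ?thesis by (rule LIMSEQ_le_const2) (use key t in auto)
qed

text \<open>
  If the moment vector were outside the cone, a form \<open>H\<close> with \<open>\<integral> H exp (- g) > 0\<close> would be
  nonpositive on the active set. Subtracting a small multiple of \<open>g\<close>, which equals \<open>1\<close> there, makes
  it negative without losing the sign of the integral, contrary to optimality. The normalisation
  needed for the alternative is given by the coefficients of \<open>g\<close>.
\<close>

lemma optimal_moments_in_cone:
  fixes K :: "(real ^ 'n::finite) set"
  assumes opt: "optimal K d a g" and int: "g \<in> int_finvol_polys d"
    and d: "d > 0" and K: "compact K"
  shows "\<exists>w x. (\<forall>j < (CARD('n) + d - 1) choose d. 0 \<le> w j \<and> x j \<in> {x \<in> translate K a. g x = 1})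
    \<and> (\<forall>\<alpha>. mdeg \<alpha> = d \<longrightarrow> (\<integral>x. mpow x \<alpha> * exp (- g x) \<partial>lborel)
          = (\<Sum>j < (CARD('n) + d - 1) choose d. w j * mpow (x j) \<alpha>))"
proof -
  define V where "V = {x \<in> translate K a. g x = 1}"
  define I where "I = {\<alpha> :: 'n \<Rightarrow> nat. mdeg \<alpha> = d}"
  define y where "y \<alpha> = (\<integral>x. mpow x \<alpha> * exp (- g x) \<partial>lborel)" for \<alpha> :: "'n \<Rightarrow> nat"
  have fin: "g \<in> finvol_polys d" by (rule int_finvol_polys_imp[OF int])
  then have hom: "g \<in> hom_polys d" by (simp add: finvol_polys_def)
  have pos: "0 < (\<integral>x. g x * exp (- g x) \<partial>lborel)"
  proof -
    have "(\<integral>x. exp (- g x) \<partial>lborel) \<noteq> 0"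
    proof
      assume "(\<integral>x. exp (- g x) \<partial>lborel) = 0"
      then have "AE x in lborel. exp (- g x) = 0"
        by (subst (asm) integral_nonneg_eq_0_iff_AE) (use finvol_polys_exp(1)[OF fin d] in auto)
      then have "AE x in (lborel :: (real ^ 'n) measure). False" by simp
      then have "emeasure lborel (UNIV :: (real ^ 'n) set) = 0"
        by (subst (asm) AE_iff_measurable[of UNIV]) auto
      then show False by simp
    qed
    moreover have "0 \<le> (\<integral>x. exp (- g x) \<partial>lborel)" by (intro integral_nonneg_AE) simp
    ultimately have "0 < (\<integral>x. exp (- g x) \<partial>lborel)" by linarith
    then show ?thesis using d by (simp add: euler_identity(2)[OF fin d])
  qed
  \<comment> \<open>Without active constraints, \<open>g\<close> itself would be an admissible direction.\<close>
  have "V \<noteq> {}"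
  proof
    assume "V = {}"
    then have "(\<integral>x. g x * exp (- g x) \<partial>lborel) \<le> 0"
      by (intro optimal_no_descent_direction[OF opt int hom d K]) (auto simp: V_def)
    then show False using pos by simp
  qed
  moreover have "compact V"
  proof -
    have "closed {x. g x = 1}" using continuous_on_hom_polys[OF hom] by (intro closed_Collect_eq) auto
    then have "compact (translate K a \<inter> {x. g x = 1})" using compact_translate[OF K] by (rule compact_Int_closed[rotated])
    then show ?thesis by (simp add: V_def Collect_conj_eq)
  qed
  moreover obtain c where c: "g = (\<lambda>x. \<Sum>\<alpha>\<in>I. c \<alpha> * mpow x \<alpha>)"
    using hom unfolding hom_polys_def I_def by blast
  then have "(\<Sum>\<alpha>\<in>I. c \<alpha> * mpow v \<alpha>) = 1" if "v \<in> V" for v using that by (simp add: V_def)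
  moreover have "finite I" by (simp add: I_def finite_mdeg_eq)
  ultimately consider w x where "\<forall>j<card I. 0 \<le> w j \<and> x j \<in> V" "\<forall>\<alpha>\<in>I. y \<alpha> = (\<Sum>j<card I. w j * mpow (x j) \<alpha>)"
    | h where "(\<Sum>\<alpha>\<in>I. h \<alpha> * y \<alpha>) > 0" "\<forall>v\<in>V. (\<Sum>\<alpha>\<in>I. h \<alpha> * mpow v \<alpha>) \<le> 0"
    using conic_alternative[of I V "\<lambda>\<alpha> v. mpow v \<alpha>" c y] continuous_on_mpow by blast
  then show ?thesis
  proof cases
    case 1
    then show ?thesis unfolding V_def y_def I_def card_mdeg_eq by blast
  next
    case 2
    define H where "H x = (\<Sum>\<alpha>\<in>I. h \<alpha> * mpow x \<alpha>)" for x
    have H: "H \<in> hom_polys d" unfolding hom_polys_def H_def[abs_def] I_def by blast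
    note intH = integrable_hom_polys_exp[OF int H d]
    have "(\<lambda>x. mpow x \<alpha>) \<in> hom_polys d" if "\<alpha> \<in> I" for \<alpha>
      unfolding hom_polys_span using that by (intro monomial_span_monomial finite_mdeg_eq) (simp add: I_def)
    then have im: "integrable lborel (\<lambda>x. mpow x \<alpha> * exp (- g x))" if "\<alpha> \<in> I" for \<alpha>
      using integrable_hom_polys_exp[OF int _ d] that by blast
    have "(\<integral>x. H x * exp (- g x) \<partial>lborel) = (\<integral>x. (\<Sum>\<alpha>\<in>I. h \<alpha> * (mpow x \<alpha> * exp (- g x))) \<partial>lborel)"
      by (simp add: H_def sum_distrib_right mult.assoc)
    also have "\<dots> = (\<Sum>\<alpha>\<in>I. \<integral>x. h \<alpha> * (mpow x \<alpha> * exp (- g x)) \<partial>lborel)"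
      using im by (intro Bochner_Integration.integral_sum) auto
    also have "\<dots> = (\<Sum>\<alpha>\<in>I. h \<alpha> * y \<alpha>)" by (simp add: y_def)
    finally have Hpos: "(\<integral>x. H x * exp (- g x) \<partial>lborel) > 0" using 2(1) by simp
    \<comment> \<open>Half of the integral of \<open>H exp (- g)\<close> is given away.\<close>
    define e where "e = (\<integral>x. H x * exp (- g x) \<partial>lborel) / (2 * (\<integral>x. g x * exp (- g x) \<partial>lborel))"
    have e: "e > 0" using Hpos pos by (simp add: e_def)
    have He: "(\<lambda>x. H x + (- e) * g x) \<in> hom_polys d" by (rule hom_polys_add_scaled[OF H hom])
    have "(\<integral>x. (H x + (- e) * g x) * exp (- g x) \<partial>lborel) \<le> 0"
    proof (rule optimal_no_descent_direction[OF opt int He d K])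
      fix x assume "x \<in> translate K a" "g x = 1"
      then have "H x \<le> 0" using 2(2) by (simp add: V_def H_def)
      then show "H x + (- e) * g x < 0" using \<open>g x = 1\<close> e by simp
    qed
    moreover have "(\<integral>x. (H x + (- e) * g x) * exp (- g x) \<partial>lborel)
        = (\<integral>x. H x * exp (- g x) - e * (g x * exp (- g x)) \<partial>lborel)"
      by (simp add: algebra_simps)
    moreover have "\<dots> = (\<integral>x. H x * exp (- g x) \<partial>lborel) - e * (\<integral>x. g x * exp (- g x) \<partial>lborel)"
      using intH euler_identity(1)[OF fin d] by simp
    moreover have "e * (\<integral>x. g x * exp (- g x) \<partial>lborel) = (\<integral>x. H x * exp (- g x) \<partial>lborel) / 2"
      using pos by (simp add: e_def)
    ultimately show ?thesis using Hpos by simp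
  qed
qed

section \<open>The optimality measure\<close>

lemma discrete_measure:
  fixes x :: "nat \<Rightarrow> 'a::euclidean_space" and w :: "nat \<Rightarrow> real"
  assumes w: "\<And>j. j < N \<Longrightarrow> 0 \<le> w j"
  shows "\<exists>\<mu>. sets \<mu> = sets borel \<and> finite_measure \<mu>
    \<and> (\<forall>f\<in>borel_measurable borel. (\<integral>y. f y \<partial>\<mu>) = (\<Sum>j<N. w j * f (x j)))
    \<and> (\<forall>A\<in>sets borel. emeasure \<mu> A = (\<Sum>j<N. ennreal (w j) * indicator A (x j)))"
proof -
  define P where "P = point_measure {..<N} w"
  define \<mu> where "\<mu> = distr P borel x"
  have x[measurable]: "x \<in> measurable P borel" by (simp add: P_def point_measure_def)
  have emP: "emeasure P A = (\<Sum>j\<in>A. ennreal (w j))" if "A \<subseteq> {..<N}" for A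
    using that by (simp add: P_def emeasure_point_measure_finite)
  have spP: "space P = {..<N}" by (simp add: P_def space_point_measure)
  have "finite_measure P"
    by (rule finite_measureI) (simp add: spP emP)
  then have "finite_measure \<mu>" unfolding \<mu>_def by (rule finite_measure.finite_measure_distr) simp
  moreover have "(\<integral>y. f y \<partial>\<mu>) = (\<Sum>j<N. w j * f (x j))" if "f \<in> borel_measurable borel" for f
  proof -
    have "(\<integral>y. f y \<partial>\<mu>) = (\<integral>j. f (x j) \<partial>P)" unfolding \<mu>_def using that by (intro integral_distr) simp_all
    also have "\<dots> = (\<Sum>j<N. w j * f (x j))"
      unfolding P_def using w by (subst lebesgue_integral_point_measure_finite) auto
    finally show ?thesis .
  qed
  moreover have "emeasure \<mu> A = (\<Sum>j<N. ennreal (w j) * indicator A (x j))" if "A \<in> sets borel" for A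
  proof -
    have "emeasure \<mu> A = emeasure P (x -` A \<inter> space P)" unfolding \<mu>_def using that by (intro emeasure_distr) simp_all
    also have "\<dots> = (\<Sum>j\<in>x -` A \<inter> {..<N}. ennreal (w j))" by (simp add: spP emP)
    also have "\<dots> = (\<Sum>j<N. ennreal (w j) * indicator A (x j))"
      by (intro sum.mono_neutral_cong_left) (auto split: split_indicator)
    finally show ?thesis .
  qed
  ultimately show ?thesis by (intro exI[of _ \<mu>]) (simp add: \<mu>_def)
qed

lemma supp_subset_finite:
  assumes "finite F" "emeasure \<mu> (- F) = 0"
  shows "supp \<mu> \<subseteq> F"
proof
  fix p assume "p \<in> supp \<mu>"
  moreover have "open (- F)" using assms(1) by (simp add: finite_imp_closed open_Compl)
  ultimately show "p \<in> F" using assms(2) by (auto simp: supp_def)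
qed

theorem theorem4p1:
  fixes K :: "(real ^ 'n::finite) set" and d :: nat
  assumes "even d" and "d > 0"
    and "compact K" and "interior K \<noteq> {}"
  shows "(\<exists>a g. optimal K d a g) \<and>
    (\<forall>a g. optimal K d a g \<and> g \<in> int_finvol_polys d \<longrightarrow>
      (\<exists>\<mu> \<in> meas_on (translate K a).
        (\<forall>\<alpha>. mdeg \<alpha> = d \<longrightarrow>
           integrable lebesgue (\<lambda>x. mpow x \<alpha> * exp (- g x)) \<and>
           (LINT x|lebesgue. mpow x \<alpha> * exp (- g x)) = (LINT x:translate K a|\<mu>. mpow x \<alpha>)) \<and>
        (LINT x:translate K a|\<mu>. 1 - g x) = 0 \<and>
        integrable lebesgue (\<lambda>x. exp (- g x)) \<and>
        measure \<mu> (translate K a) =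
          real CARD('n) / real d * (LINT x|lebesgue. exp (- g x)) \<and>
        supp \<mu> \<subseteq> {x \<in> translate K a. g x = 1} \<and>
        (\<exists>\<nu> \<in> meas_on (translate K a). \<exists>F.
           finite F \<and> F \<subseteq> {x \<in> translate K a. g x = 1} \<and>
           card F \<le> (CARD('n) + d - 1) choose d \<and>
           supp \<nu> \<subseteq> F \<and>
           (\<forall>\<alpha>. mdeg \<alpha> = d \<longrightarrow>
              (LINT x:translate K a|\<nu>. mpow x \<alpha>) = (LINT x:translate K a|\<mu>. mpow x \<alpha>)))))"
proof (intro conjI allI impI)
  show "\<exists>a g. optimal K d a g" by (rule optimal_exists[OF assms])
next
  fix a and g :: "real ^ 'n \<Rightarrow> real"
  assume "optimal K d a g \<and> g \<in> int_finvol_polys d"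
  then have opt: "optimal K d a g" and int: "g \<in> int_finvol_polys d" by auto
  note d = \<open>d > 0\<close>
  have fin: "g \<in> finvol_polys d" by (rule int_finvol_polys_imp[OF int])
  then have hom: "g \<in> hom_polys d" by (simp add: finvol_polys_def)
  have g_meas[measurable]: "g \<in> borel_measurable borel" by (rule borel_measurable_hom_polys[OF hom])
  have mono_meas[measurable]: "(\<lambda>x. mpow x \<alpha>) \<in> borel_measurable borel" for \<alpha> :: "'n \<Rightarrow> nat"
    by (intro borel_measurable_continuous_onI continuous_on_mpow)
  define N where "N = (CARD('n) + d - 1) choose d"
  define S where "S = translate K a"
  have S[measurable]: "S \<in> sets borel"
    unfolding S_def using compact_translate[OF assms(3)] by (simp add: borel_closed compact_imp_closed)
  obtain w x where wx: "\<And>j. j < N \<Longrightarrow> 0 \<le> w j" "\<And>j. j < N \<Longrightarrow> x j \<in> S" "\<And>j. j < N \<Longrightarrow> g (x j) = 1"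
    and mom: "\<And>\<alpha>. mdeg \<alpha> = d \<Longrightarrow> (\<integral>x. mpow x \<alpha> * exp (- g x) \<partial>lborel) = (\<Sum>j<N. w j * mpow (x j) \<alpha>)"
    using optimal_moments_in_cone[OF opt int d assms(3)] unfolding N_def S_def by blast
  obtain \<mu> :: "(real ^ 'n) measure" where \<mu>: "sets \<mu> = sets borel" "finite_measure \<mu>"
    and int\<mu>: "\<And>f. f \<in> borel_measurable borel \<Longrightarrow> (\<integral>y. f y \<partial>\<mu>) = (\<Sum>j<N. w j * f (x j))"
    and em\<mu>: "\<And>A. A \<in> sets borel \<Longrightarrow> emeasure \<mu> A = (\<Sum>j<N. ennreal (w j) * indicator A (x j))"
    using discrete_measure[of N w x] wx(1) by blast
  define F where "F = x ` {..<N}"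
  have F: "finite F" "F \<subseteq> {x \<in> S. g x = 1}" "card F \<le> N"
    using wx card_image_le[of "{..<N}" x] by (auto simp: F_def)
  have "emeasure \<mu> (- F) = 0"
    using F(1) by (subst em\<mu>) (auto simp: F_def intro!: borel_open open_Compl finite_imp_closed)
  then have supp: "supp \<mu> \<subseteq> F" by (rule supp_subset_finite[OF F(1)])
  then have meas: "\<mu> \<in> meas_on S" using \<mu> F(2) by (auto simp: meas_on_def)
  have setint: "(LINT y:S|\<mu>. f y) = (\<Sum>j<N. w j * f (x j))" if [measurable]: "f \<in> borel_measurable borel" for f :: "real ^ 'n \<Rightarrow> real"
    unfolding set_lebesgue_integral_def using wx(2) by (subst int\<mu>) (auto intro!: sum.cong)
  have moments: "(LINT x|lebesgue. mpow x \<alpha> * exp (- g x)) = (LINT x:S|\<mu>. mpow x \<alpha>)" if "mdeg \<alpha> = d" for \<alpha>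
    using mom[OF that] by (simp add: setint integral_completion)
  have int_mono: "integrable lebesgue (\<lambda>x. mpow x \<alpha> * exp (- g x))" if "mdeg \<alpha> = d" for \<alpha>
  proof -
    have "(\<lambda>x. mpow x \<alpha>) \<in> hom_polys d"
      unfolding hom_polys_span using that by (intro monomial_span_monomial finite_mdeg_eq) simp
    then show ?thesis using integrable_hom_polys_exp[OF int _ d] by (simp add: integrable_completion)
  qed
  have slack: "(LINT x:S|\<mu>. 1 - g x) = 0" using wx(3) by (simp add: setint)
  have int_exp: "integrable lebesgue (\<lambda>x. exp (- g x))"
    using finvol_polys_exp(1)[OF fin d] by (simp add: integrable_completion)
  have mass: "measure \<mu> S = real CARD('n) / real d * (LINT x|lebesgue. exp (- g x))"
  proof -
    obtain c where c: "g = (\<lambda>x. \<Sum>\<alpha> | mdeg \<alpha> = d. c \<alpha> * mpow x \<alpha>)"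
      using hom unfolding hom_polys_def by blast
    \<comment> \<open>As \<open>g = 1\<close> at the atoms, the mass is the integral of \<open>g\<close>, a combination of matched moments.\<close>
    have "measure \<mu> S = (\<integral>y. indicator S y \<partial>\<mu>)" using \<mu> by (simp add: sets_eq_imp_space_eq[OF \<mu>(1)])
    also have "\<dots> = (\<Sum>j<N. w j * g (x j))" using wx by (subst int\<mu>) (auto intro!: sum.cong)
    also have "\<dots> = (\<Sum>j<N. \<Sum>\<alpha> | mdeg \<alpha> = d. c \<alpha> * (w j * mpow (x j) \<alpha>))"
      unfolding c by (simp add: sum_distrib_left mult.left_commute)
    also have "\<dots> = (\<Sum>\<alpha> | mdeg \<alpha> = d. c \<alpha> * (\<Sum>j<N. w j * mpow (x j) \<alpha>))"
      unfolding sum_distrib_left by (rule sum.swap)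
    also have "\<dots> = (\<Sum>\<alpha> | mdeg \<alpha> = d. \<integral>x. c \<alpha> * (mpow x \<alpha> * exp (- g x)) \<partial>lborel)"
      using mom by (intro sum.cong) auto
    also have "\<dots> = (\<integral>x. (\<Sum>\<alpha> | mdeg \<alpha> = d. c \<alpha> * (mpow x \<alpha> * exp (- g x))) \<partial>lborel)"
      using int_mono by (intro Bochner_Integration.integral_sum[symmetric]) (auto simp: integrable_completion)
    also have "\<dots> = (\<integral>x. (\<Sum>\<alpha> | mdeg \<alpha> = d. c \<alpha> * mpow x \<alpha>) * exp (- g x) \<partial>lborel)"
      by (simp add: sum_distrib_right mult.assoc)
    also have "\<dots> = (\<integral>x. g x * exp (- g x) \<partial>lborel)"
      by (simp only: fun_cong[OF c, symmetric])
    finally show ?thesis by (simp add: euler_identity(2)[OF fin d] integral_completion)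
  qed
  show "\<exists>\<mu> \<in> meas_on (translate K a).
        (\<forall>\<alpha>. mdeg \<alpha> = d \<longrightarrow>
           integrable lebesgue (\<lambda>x. mpow x \<alpha> * exp (- g x)) \<and>
           (LINT x|lebesgue. mpow x \<alpha> * exp (- g x)) = (LINT x:translate K a|\<mu>. mpow x \<alpha>)) \<and>
        (LINT x:translate K a|\<mu>. 1 - g x) = 0 \<and>
        integrable lebesgue (\<lambda>x. exp (- g x)) \<and>
        measure \<mu> (translate K a) =
          real CARD('n) / real d * (LINT x|lebesgue. exp (- g x)) \<and>
        supp \<mu> \<subseteq> {x \<in> translate K a. g x = 1} \<and>
        (\<exists>\<nu> \<in> meas_on (translate K a). \<exists>F.
           finite F \<and> F \<subseteq> {x \<in> translate K a. g x = 1} \<and>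
           card F \<le> (CARD('n) + d - 1) choose d \<and>
           supp \<nu> \<subseteq> F \<and>
           (\<forall>\<alpha>. mdeg \<alpha> = d \<longrightarrow>
              (LINT x:translate K a|\<nu>. mpow x \<alpha>) = (LINT x:translate K a|\<mu>. mpow x \<alpha>)))"
    using meas moments int_mono slack int_exp mass subset_trans[OF supp F(2)] F supp
    unfolding S_def N_def by blast
qed

end
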